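(* Let $\zeta$ be a harmonic unit vector field with totally geodesic integral curves on the flat torus $\mathbb{T}^3$. Then either $\zeta$ is parallel, or $\zeta$ is a rotation along a parallel vector field.
   Context: The flat torus $\mathbb{T}^3$ is a quotient of Euclidean $\mathbb{R}^3$ by a lattice, with the induced flat metric. A unit vector field $\zeta$ on a Riemannian manifold is called a harmonic unit vector field if $\nabla^*\nabla\zeta=|\nabla\zeta|^2\zeta$, where $\nabla$ is the Levi-Civita connection and $\nabla^*\nabla=-\operatorname{tr}\nabla^2_{\cdot,\cdot}$ is the rough Laplacian. Totally geodesic integral curves means $\nabla_\zeta\zeta=0$. We say that $\zeta$ is a rotation along a parallel vector field if there are Euclidean (orthonormal) coordinates $(x,y,z)$ on the universal cover $\mathbb{R}^3$ and a non-zero real number $\alpha$ such that the lift of $\zeta$ is $\cos(\alpha x)\,\partial_y-\sin(\alpha x)\,\partial_z$ (so $\zeta$ is orthogonal to the parallel field $\partial_x$ and rotates at constant speed along it). *)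

theory Defs
  imports "HOL-Analysis.Analysis"
begin

definition lattice :: "'a::euclidean_space set \<Rightarrow> bool" where
  "lattice L \<longleftrightarrow> (\<exists>B. independent B \<and> span B = UNIV \<and>
      L = {\<Sum>b\<in>B. of_int (k b) *\<^sub>R b | k :: 'a \<Rightarrow> int. True})"

definition lattice_rel :: "'a::euclidean_space set \<Rightarrow> ('a \<times> 'a) set" where
  "lattice_rel L = {(p, q). q - p \<in> L}"

definition flat_torus :: "'a::euclidean_space set \<Rightarrow> 'a set set" where
  "flat_torus L = UNIV // lattice_rel L"

definition torus_proj :: "'a::euclidean_space set \<Rightarrow> 'a \<Rightarrow> 'a set" where
  "torus_proj L p = lattice_rel L `` {p}"

(* The differential of torus_proj identifies every tangent space of the torus isometrically with
   the Euclidean space itself, independently of the chosen preimage, because lattice translations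
   have identity differential. A vector field on the torus is therefore a function
   from flat_torus L to 'a. Its values outside flat_torus L are never used. *)

definition lift :: "'a::euclidean_space set \<Rightarrow> ('a set \<Rightarrow> 'a) \<Rightarrow> 'a \<Rightarrow> 'a" where
  "lift L \<zeta> = (\<lambda>p. \<zeta> (torus_proj L p))"

lemma torus_proj_in_flat_torus: "torus_proj L p \<in> flat_torus L"
  by (simp add: torus_proj_def flat_torus_def quotientI)

primrec Ck :: "nat \<Rightarrow> ('a::real_normed_vector \<Rightarrow> 'b::real_normed_vector) \<Rightarrow> bool" where
  "Ck 0 f \<longleftrightarrow> continuous_on UNIV f"
| "Ck (Suc k) f \<longleftrightarrow> (\<forall>p. f differentiable (at p)) \<and>
     (\<forall>v. Ck k (\<lambda>p. frechet_derivative f (at p) v))"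

definition smooth :: "('a::real_normed_vector \<Rightarrow> 'b::real_normed_vector) \<Rightarrow> bool" where
  "smooth f \<longleftrightarrow> (\<forall>k. Ck k f)"

(* torus_proj is a local isometry, so the Levi-Civita connection of the flat torus acts on lifts
   as that of Euclidean space: cov_deriv X Z is the field nabla_X Z. *)
definition cov_deriv ::
    "('a::euclidean_space \<Rightarrow> 'a) \<Rightarrow> ('a \<Rightarrow> 'a) \<Rightarrow> 'a \<Rightarrow> 'a" where
  "cov_deriv X Z = (\<lambda>p. frechet_derivative Z (at p) (X p))"

definition second_cov_deriv ::
    "('a::euclidean_space \<Rightarrow> 'a) \<Rightarrow> ('a \<Rightarrow> 'a) \<Rightarrow> ('a \<Rightarrow> 'a) \<Rightarrow> 'a \<Rightarrow> 'a" where
  "second_cov_deriv X Y Z =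
     (\<lambda>p. cov_deriv X (cov_deriv Y Z) p - cov_deriv (cov_deriv X Y) Z p)"

(* Traces are taken in the orthonormal frame of constant fields given by Basis. *)
definition rough_laplacian :: "('a::euclidean_space \<Rightarrow> 'a) \<Rightarrow> 'a \<Rightarrow> 'a" where
  "rough_laplacian Z p = - (\<Sum>b\<in>Basis. second_cov_deriv (\<lambda>_. b) (\<lambda>_. b) Z p)"

definition cov_norm_sq :: "('a::euclidean_space \<Rightarrow> 'a) \<Rightarrow> 'a \<Rightarrow> real" where
  "cov_norm_sq Z p = (\<Sum>b\<in>Basis. (norm (cov_deriv (\<lambda>_. b) Z p))\<^sup>2)"

definition unit_vector_field :: "'a::euclidean_space set \<Rightarrow> ('a set \<Rightarrow> 'a) \<Rightarrow> bool" where
  "unit_vector_field L \<zeta> \<longleftrightarrow> smooth (lift L \<zeta>) \<and> (\<forall>c\<in>flat_torus L. norm (\<zeta> c) = 1)"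

definition harmonic_unit_vector_field ::
    "'a::euclidean_space set \<Rightarrow> ('a set \<Rightarrow> 'a) \<Rightarrow> bool" where
  "harmonic_unit_vector_field L \<zeta> \<longleftrightarrow> unit_vector_field L \<zeta> \<and>
     (\<forall>p. rough_laplacian (lift L \<zeta>) p = cov_norm_sq (lift L \<zeta>) p *\<^sub>R lift L \<zeta> p)"

definition totally_geodesic_integral_curves ::
    "'a::euclidean_space set \<Rightarrow> ('a set \<Rightarrow> 'a) \<Rightarrow> bool" where
  "totally_geodesic_integral_curves L \<zeta> \<longleftrightarrow>
     (\<forall>p. cov_deriv (lift L \<zeta>) (lift L \<zeta>) p = 0)"

definition parallel_field :: "'a::euclidean_space set \<Rightarrow> ('a set \<Rightarrow> 'a) \<Rightarrow> bool" where
  "parallel_field L \<zeta> \<longleftrightarrow> (\<forall>X p. cov_deriv X (lift L \<zeta>) p = 0)"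

(* The Euclidean coordinates are centred at q with axes u, v, w: the coordinate x of a point p is
   (p - q) \<bullet> u, and the coordinate fields are the constants u, v, w. Both orientations
   are allowed. *)
definition rotation_along_parallel ::
    "(real^3) set \<Rightarrow> ((real^3) set \<Rightarrow> real^3) \<Rightarrow> bool" where
  "rotation_along_parallel L \<zeta> \<longleftrightarrow>
     (\<exists>q u v w :: real^3. \<exists>\<alpha> :: real.
        norm u = 1 \<and> norm v = 1 \<and> norm w = 1 \<and> u \<bullet> v = 0 \<and> u \<bullet> w = 0 \<and> v \<bullet> w = 0 \<and>
        \<alpha> \<noteq> 0 \<and>
        (\<forall>p. lift L \<zeta> p =
           cos (\<alpha> * ((p - q) \<bullet> u)) *\<^sub>R v - sin (\<alpha> * ((p - q) \<bullet> u)) *\<^sub>R w))"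

end

theory Submission
  imports Defs
begin

text \<open>
  Let \<open>Z\<close> be the lift of the field to Euclidean space, write \<open>DZ\<close> for its derivative, and let
  \<open>\<tau>\<close> and \<open>\<delta>\<close> be the trace of \<open>DZ\<close> and the sum of its principal \<open>2 \<times> 2\<close> minors.

  \<^bold>\<open>Geometry forces nilpotency.\<close> Because the integral curves are straight, \<open>Z\<close> is constant along the
  line through \<open>p\<close> with direction \<open>Z p\<close> (\<open>constant_along_geodesic_lines\<close>), so \<open>p \<mapsto> p + t Z p\<close> is
  injective with inverse \<open>p \<mapsto> p - t Z p\<close>. Its Jacobian determinant \<open>1 + t \<tau> + t\<^sup>2 \<delta>\<close> therefore has
  no real zero \<open>t\<close>; hence \<open>\<delta> \<ge> 0\<close>, and \<open>\<delta> = 0\<close> forces \<open>\<tau> = 0\<close>. For \<open>t = 1\<close> and \<open>t = -1\<close> the map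
  moves points by distance one, so the volume of the image of a ball exceeds that of the ball by
  at most the volume of a shell. Adding the two bounds, \<open>\<delta>\<close> has an integral over a ball of radius
  \<open>R\<close> that grows like \<open>R\<^sup>2\<close> only. But \<open>\<delta>\<close> is invariant under the lattice, and one point with
  \<open>\<delta> > 0\<close> would make the integral grow like \<open>R\<^sup>3\<close>. So \<open>\<delta> = \<tau> = 0\<close>
  (\<open>geodesic_trace_minors2_eq_0\<close>).

  \<^bold>\<open>A Beltrami field.\<close> Now \<open>DZ\<close> is nilpotent, kills \<open>Z\<close> and takes values orthogonal to \<open>Z\<close>. Linear
  algebra gives \<open>curl Z = \<mu> Z\<close> and \<open>|DZ|\<^sup>2 = \<mu>\<^sup>2\<close> for a smooth function \<open>\<mu>\<close>. Taking the divergence of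
  \<open>curl Z = \<mu> Z\<close> shows that the gradient of \<open>\<mu>\<close> is orthogonal to \<open>Z\<close>; taking the curl and using
  \<open>curl (curl Z) = - \<Delta> Z = \<mu>\<^sup>2 Z\<close>, which is harmonicity, shows that the gradient is parallel to \<open>Z\<close>.
  So \<open>\<mu>\<close> is a constant \<open>m\<close> (\<open>\<mu>_derivative_zero\<close>).

  \<^bold>\<open>The Hessian.\<close> The Bochner identity for the constant function \<open>|DZ|\<^sup>2 = m\<^sup>2\<close> gives
  \<open>|D\<^sup>2Z|\<^sup>2 = m\<^sup>4\<close>. The part of the Hessian along \<open>Z\<close> has coefficients
  \<open>- \<langle>D\<^sub>iZ, D\<^sub>jZ\<rangle>\<close>, whose squares already add up to \<open>m\<^sup>4\<close> because \<open>DZ\<close> has rank at most one. So the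
  Hessian has no other part (\<open>hessian\<close>). Consequently the Gram matrix \<open>\<langle>D\<^sub>iZ, D\<^sub>jZ\<rangle>\<close> is constant;
  it has rank one and equals \<open>m\<^sup>2 u\<^sub>i u\<^sub>j\<close> for a unit vector \<open>u\<close>, the axis of the rotation. What
  remains is the linear system \<open>D\<^sub>vZ = \<langle>v, u\<rangle> W\<close>, \<open>D\<^sub>vW = - m\<^sup>2 \<langle>v, u\<rangle> Z\<close>, solved by sine and cosine
  of \<open>m \<langle>p, u\<rangle>\<close>. If \<open>m = 0\<close> the field is parallel.
\<close>

section \<open>Directional derivatives\<close>

definition dirderiv ::
    "'a::real_normed_vector \<Rightarrow> ('a \<Rightarrow> 'b::real_normed_vector) \<Rightarrow> 'a \<Rightarrow> 'b" where
  "dirderiv v f p = frechet_derivative f (at p) v"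

lemma dirderiv_eqI: "(f has_derivative f') (at p) \<Longrightarrow> dirderiv v f p = f' v"
  unfolding dirderiv_def using frechet_derivative_at by metis

lemma has_derivative_dirderiv:
  "f differentiable (at p) \<Longrightarrow> (f has_derivative (\<lambda>v. dirderiv v f p)) (at p)"
  unfolding dirderiv_def by (simp add: frechet_derivative_works)

lemma linear_dirderiv: "f differentiable (at p) \<Longrightarrow> linear (\<lambda>v. dirderiv v f p)"
  unfolding dirderiv_def by (rule linear_frechet_derivative)

lemma smooth_differentiable: "smooth f \<Longrightarrow> f differentiable (at p)"
  unfolding smooth_def using Ck.simps(2) by blast

lemma smooth_dirderiv: "smooth f \<Longrightarrow> smooth (dirderiv v f)"
  unfolding smooth_def dirderiv_def[abs_def] using Ck.simps(2) by blast

lemma smooth_continuous_on: "smooth f \<Longrightarrow> continuous_on S f"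
  using Ck.simps(1) continuous_on_subset unfolding smooth_def by blast

lemma dirderiv_const [simp]: "dirderiv v (\<lambda>p. c) p = 0"
  by (simp add: dirderiv_def)

lemma dirderiv_inner:
  fixes f g :: "'a::real_normed_vector \<Rightarrow> 'b::real_inner"
  assumes "f differentiable (at p)" "g differentiable (at p)"
  shows "dirderiv v (\<lambda>p. f p \<bullet> g p) p = dirderiv v f p \<bullet> g p + f p \<bullet> dirderiv v g p"
  using dirderiv_eqI[OF has_derivative_inner[OF has_derivative_dirderiv[OF assms(1)]
        has_derivative_dirderiv[OF assms(2)]]]
  by (simp add: add.commute)

lemma dirderiv_sum:
  assumes "\<And>i. i \<in> I \<Longrightarrow> f i differentiable (at p)"
  shows "dirderiv v (\<lambda>p. \<Sum>i\<in>I. f i p) p = (\<Sum>i\<in>I. dirderiv v (f i) p)"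
  using assms by (intro dirderiv_eqI has_derivative_sum has_derivative_dirderiv) auto

lemma dirderiv_scaleR:
  assumes "h differentiable (at p)" "f differentiable (at p)"
  shows "dirderiv v (\<lambda>p. h p *\<^sub>R f p) p = dirderiv v h p *\<^sub>R f p + h p *\<^sub>R dirderiv v f p"
  using dirderiv_eqI[OF has_derivative_scaleR[OF has_derivative_dirderiv[OF assms(1)]
        has_derivative_dirderiv[OF assms(2)]]]
  by (simp add: add.commute)

lemma differentiable_inner_right:
  "f differentiable (at p) \<Longrightarrow> (\<lambda>p. f p \<bullet> b) differentiable (at p)"
  unfolding differentiable_def using has_derivative_inner_left by fast

lemma dirderiv_inner_left:
  assumes "f differentiable (at p)"
  shows "dirderiv v (\<lambda>p. f p \<bullet> b) p = dirderiv v f p \<bullet> b"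
  using dirderiv_eqI[OF has_derivative_inner_left[OF has_derivative_dirderiv[OF assms]]] by simp

lemma has_real_derivative_along_line:
  assumes "f differentiable (at (p + t *\<^sub>R v))"
  shows "((\<lambda>t. f (p + t *\<^sub>R v)) has_real_derivative dirderiv v f (p + t *\<^sub>R v)) (at t)"
proof -
  have "((\<lambda>t. p + t *\<^sub>R v) has_derivative (\<lambda>h. h *\<^sub>R v)) (at t)"
    by (auto intro!: derivative_eq_intros)
  from diff_chain_at[OF this has_derivative_dirderiv[OF assms]]
  have "((\<lambda>t. f (p + t *\<^sub>R v)) has_derivative (\<lambda>h. dirderiv (h *\<^sub>R v) f (p + t *\<^sub>R v))) (at t)"
    by (simp add: o_def)
  moreover have "dirderiv (h *\<^sub>R v) f (p + t *\<^sub>R v) = h * dirderiv v f (p + t *\<^sub>R v)" for h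
    using linear_scale[OF linear_dirderiv[OF assms]] by auto
  ultimately show ?thesis
    by (simp add: has_field_derivative_def mult_commute_abs)
qed

text \<open>
  The second difference of \<open>f\<close> over a parallelogram is symmetric in its two sides, while the mean
  value theorem, applied along one side and then along the other, turns it into an iterated
  derivative at a nearby point. Shrinking the parallelogram exchanges the order of differentiation.
\<close>

lemma second_difference_mean_value:
  fixes f :: "'a::real_normed_vector \<Rightarrow> real"
  assumes df: "\<And>p. f differentiable (at p)" and dvf: "\<And>p. dirderiv v f differentiable (at p)"
    and "s > 0"
  shows "\<exists>x y. 0 < x \<and> x < s \<and> 0 < y \<and> y < s \<and>
    f (p + s *\<^sub>R v + s *\<^sub>R w) - f (p + s *\<^sub>R v) - f (p + s *\<^sub>R w) + f p
      = s * s * dirderiv w (dirderiv v f) (p + x *\<^sub>R v + y *\<^sub>R w)"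
proof -
  define g where "g t = f ((p + s *\<^sub>R w) + t *\<^sub>R v) - f (p + t *\<^sub>R v)" for t
  have "DERIV g t :> dirderiv v f ((p + s *\<^sub>R w) + t *\<^sub>R v) - dirderiv v f (p + t *\<^sub>R v)" for t
    unfolding g_def by (intro DERIV_diff has_real_derivative_along_line df)
  then obtain x where x: "0 < x" "x < s"
    "g s - g 0 = (s - 0) * (dirderiv v f ((p + s *\<^sub>R w) + x *\<^sub>R v) - dirderiv v f (p + x *\<^sub>R v))"
    using MVT2[OF \<open>s > 0\<close>, of g
        "\<lambda>t. dirderiv v f ((p + s *\<^sub>R w) + t *\<^sub>R v) - dirderiv v f (p + t *\<^sub>R v)"]
    by blast
  have "DERIV (\<lambda>t. dirderiv v f ((p + x *\<^sub>R v) + t *\<^sub>R w)) t :>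
     dirderiv w (dirderiv v f) ((p + x *\<^sub>R v) + t *\<^sub>R w)" for t
    by (intro has_real_derivative_along_line dvf)
  then obtain y where y: "0 < y" "y < s"
    "dirderiv v f ((p + x *\<^sub>R v) + s *\<^sub>R w) - dirderiv v f ((p + x *\<^sub>R v) + 0 *\<^sub>R w)
       = (s - 0) * dirderiv w (dirderiv v f) ((p + x *\<^sub>R v) + y *\<^sub>R w)"
    using MVT2[OF \<open>s > 0\<close>, of "\<lambda>t. dirderiv v f ((p + x *\<^sub>R v) + t *\<^sub>R w)"
        "\<lambda>t. dirderiv w (dirderiv v f) ((p + x *\<^sub>R v) + t *\<^sub>R w)"] by blast
  have "g s - g 0 = f (p + s *\<^sub>R v + s *\<^sub>R w) - f (p + s *\<^sub>R v) - f (p + s *\<^sub>R w) + f p"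
    by (simp add: g_def algebra_simps)
  moreover have "g s - g 0 = s * s * dirderiv w (dirderiv v f) (p + x *\<^sub>R v + y *\<^sub>R w)"
    using x(3) y(3) by (simp add: algebra_simps)
  ultimately show ?thesis
    using x y by metis
qed

lemma second_difference_quotient_limit:
  fixes f :: "'a::real_normed_vector \<Rightarrow> real"
  assumes df: "\<And>p. f differentiable (at p)" and dvf: "\<And>p. dirderiv v f differentiable (at p)"
    and cont: "isCont (dirderiv w (dirderiv v f)) p"
  shows "((\<lambda>s. (f (p + s *\<^sub>R v + s *\<^sub>R w) - f (p + s *\<^sub>R v) - f (p + s *\<^sub>R w) + f p) / (s * s))
      \<longlongrightarrow> dirderiv w (dirderiv v f) p) (at_right 0)"
proof -
  define Q where "Q s = (f (p + s *\<^sub>R v + s *\<^sub>R w) - f (p + s *\<^sub>R v) - f (p + s *\<^sub>R w) + f p) / (s * s)" for s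
  have "\<exists>q. norm (q - p) \<le> s * (norm v + norm w) \<and> Q s = dirderiv w (dirderiv v f) q" if s: "s > 0" for s
  proof -
    obtain x y where xy: "0 < x" "x < s" "0 < y" "y < s"
      and eq: "f (p + s *\<^sub>R v + s *\<^sub>R w) - f (p + s *\<^sub>R v) - f (p + s *\<^sub>R w) + f p
        = s * s * dirderiv w (dirderiv v f) (p + x *\<^sub>R v + y *\<^sub>R w)"
      using second_difference_mean_value[OF df dvf s] by blast
    have "norm ((p + x *\<^sub>R v + y *\<^sub>R w) - p) \<le> norm (x *\<^sub>R v) + norm (y *\<^sub>R w)"
      by (metis add.assoc add_diff_cancel_left' norm_triangle_ineq)
    also have "\<dots> \<le> s * norm v + s * norm w"
      using xy by (intro add_mono) (auto simp: mult_right_mono)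
    finally show ?thesis
      using eq s by (intro exI[of _ "p + x *\<^sub>R v + y *\<^sub>R w"]) (auto simp: Q_def algebra_simps)
  qed
  then obtain q where q: "\<And>s. s > 0 \<Longrightarrow> norm (q s - p) \<le> s * (norm v + norm w)"
    "\<And>s. s > 0 \<Longrightarrow> Q s = dirderiv w (dirderiv v f) (q s)"
    by metis
  have "((\<lambda>s. q s - p) \<longlongrightarrow> 0) (at_right 0)"
  proof (rule Lim_null_comparison)
    show "\<forall>\<^sub>F s in at_right 0. norm (q s - p) \<le> s * (norm v + norm w)"
      using q(1) by (auto simp: eventually_at_right_less eventually_at_filter)
    show "((\<lambda>s. s * (norm v + norm w)) \<longlongrightarrow> 0) (at_right 0)"
      by (rule tendsto_eq_intros refl | simp)+
  qed
  then have "(q \<longlongrightarrow> p) (at_right 0)"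
    by (simp add: LIM_zero_iff)
  then have "((\<lambda>s. dirderiv w (dirderiv v f) (q s)) \<longlongrightarrow> dirderiv w (dirderiv v f) p) (at_right 0)"
    using cont isCont_tendsto_compose by blast
  then have "(Q \<longlongrightarrow> dirderiv w (dirderiv v f) p) (at_right 0)"
    by (rule Lim_transform_eventually) (use q(2) in \<open>auto simp: eventually_at_filter\<close>)
  then show ?thesis
    by (simp add: Q_def[abs_def])
qed

lemma dirderiv_commute_real:
  fixes f :: "'a::real_normed_vector \<Rightarrow> real"
  assumes df: "\<And>p. f differentiable (at p)"
    and ddf: "\<And>u p. dirderiv u f differentiable (at p)"
    and cont: "\<And>u u' p. isCont (dirderiv u (dirderiv u' f)) p"
  shows "dirderiv v (dirderiv w f) p = dirderiv w (dirderiv v f) p"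
proof (rule tendsto_unique)
  show "((\<lambda>s. (f (p + s *\<^sub>R v + s *\<^sub>R w) - f (p + s *\<^sub>R v) - f (p + s *\<^sub>R w) + f p) / (s * s))
      \<longlongrightarrow> dirderiv w (dirderiv v f) p) (at_right 0)"
    by (rule second_difference_quotient_limit[OF df ddf cont])
  show "((\<lambda>s. (f (p + s *\<^sub>R v + s *\<^sub>R w) - f (p + s *\<^sub>R v) - f (p + s *\<^sub>R w) + f p) / (s * s))
      \<longlongrightarrow> dirderiv v (dirderiv w f) p) (at_right 0)"
    using second_difference_quotient_limit[OF df ddf cont, of p w v]
    by (simp add: algebra_simps)
qed simp

text \<open>
  A field with values in a Euclidean space is treated coordinate by coordinate, since the mean value
  theorem is only available for real functions.
\<close>

lemma dirderiv_commute:
  fixes f :: "'a::real_normed_vector \<Rightarrow> 'b::euclidean_space"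
  assumes "smooth f"
  shows "dirderiv v (dirderiv w f) p = dirderiv w (dirderiv v f) p"
proof (rule euclidean_eqI)
  fix b :: 'b assume "b \<in> Basis"
  have d: "f differentiable (at p)" "dirderiv u f differentiable (at p)" for u p
    using assms smooth_differentiable smooth_dirderiv by blast+
  have eq1: "dirderiv u (\<lambda>p. f p \<bullet> b) = (\<lambda>p. dirderiv u f p \<bullet> b)" for u
    by (intro ext dirderiv_inner_left d)
  have eq2: "dirderiv u (\<lambda>p. dirderiv u' f p \<bullet> b) = (\<lambda>p. dirderiv u (dirderiv u' f) p \<bullet> b)" for u u'
    by (intro ext dirderiv_inner_left d)
  have c: "isCont (dirderiv u (dirderiv u' f)) p" for u u' p
    using assms smooth_dirderiv smooth_continuous_on[of _ UNIV] continuous_on_eq_continuous_at by blast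
  have "dirderiv v (dirderiv w (\<lambda>p. f p \<bullet> b)) p = dirderiv w (dirderiv v (\<lambda>p. f p \<bullet> b)) p"
    by (rule dirderiv_commute_real)
       (auto simp: eq1 eq2 intro!: differentiable_inner_right d continuous_intros c)
  then show "dirderiv v (dirderiv w f) p \<bullet> b = dirderiv w (dirderiv v f) p \<bullet> b"
    by (simp add: eq1 eq2)
qed

lemma differentiable_inner:
  fixes f g :: "'a::real_normed_vector \<Rightarrow> 'b::real_inner"
  shows "f differentiable (at p) \<Longrightarrow> g differentiable (at p) \<Longrightarrow> (\<lambda>p. f p \<bullet> g p) differentiable (at p)"
  unfolding differentiable_def using has_derivative_inner by fast

lemma constant_of_derivative_eq_0:
  fixes f :: "'a::real_normed_vector \<Rightarrow> 'b::real_normed_vector"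
  assumes "\<And>p. (f has_derivative (\<lambda>v. 0)) (at p)"
  shows "f p = f q"
proof -
  obtain c where "\<And>p. f p = c"
    using has_derivative_zero_constant[of UNIV f] assms by auto
  then show ?thesis by simp
qed

lemma constant_of_dirderiv_eq_0:
  fixes f :: "'a::real_normed_vector \<Rightarrow> 'b::real_normed_vector"
  assumes "\<And>p. f differentiable (at p)" "\<And>v p. dirderiv v f p = 0"
  shows "f p = f q"
  using has_derivative_dirderiv[OF assms(1)] by (intro constant_of_derivative_eq_0) (simp add: assms(2))

lemma dirderiv_bounded_on_compact:
  fixes f :: "'a::euclidean_space \<Rightarrow> 'b::real_normed_vector"
  assumes "smooth f" "compact S"
  obtains K where "K > 0" "\<And>v p. p \<in> S \<Longrightarrow> norm (dirderiv v f p) \<le> K * norm v"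
proof -
  let ?B = "\<lambda>p. \<Sum>b\<in>Basis. norm (dirderiv b f p)"
  have "continuous_on S ?B"
    using assms(1) by (intro continuous_intros smooth_continuous_on smooth_dirderiv)
  then have "bounded (?B ` S)"
    using assms(2) compact_continuous_image compact_imp_bounded by blast
  then obtain K where K: "K > 0" "\<And>p. p \<in> S \<Longrightarrow> norm (?B p) \<le> K"
    unfolding bounded_pos by blast
  have "norm (dirderiv v f p) \<le> K * norm v" if p: "p \<in> S" for v p
  proof -
    have lin: "linear (\<lambda>v. dirderiv v f p)"
      by (intro linear_dirderiv smooth_differentiable assms)
    have "dirderiv v f p = dirderiv (\<Sum>b\<in>Basis. (v \<bullet> b) *\<^sub>R b) f p"
      by (simp add: euclidean_representation)
    also have "\<dots> = (\<Sum>b\<in>Basis. (v \<bullet> b) *\<^sub>R dirderiv b f p)"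
      by (simp add: linear_sum[OF lin] linear_scale[OF lin])
    also have "norm \<dots> \<le> (\<Sum>b\<in>Basis. norm v * norm (dirderiv b f p))"
      by (intro sum_norm_le) (auto simp: Basis_le_norm mult_right_mono)
    also have "\<dots> = ?B p * norm v"
      by (simp add: sum_distrib_left mult.commute)
    also have "\<dots> \<le> K * norm v"
      using K(2)[OF p] by (intro mult_right_mono) auto
    finally show ?thesis .
  qed
  then show ?thesis
    using K(1) that by blast
qed

section \<open>Periodic functions of small growth\<close>

lemma lattice_diff:
  assumes "lattice L" "x \<in> L" "y \<in> L"
  shows "x - y \<in> L"
proof -
  obtain B where L: "L = {\<Sum>b\<in>B. of_int (k b) *\<^sub>R b | k :: 'a \<Rightarrow> int. True}"
    using assms(1) unfolding lattice_def by blast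
  obtain k k' where "x = (\<Sum>b\<in>B. of_int (k b) *\<^sub>R b)" "y = (\<Sum>b\<in>B. of_int (k' b) *\<^sub>R b)"
    using assms(2,3) unfolding L by blast
  then have "x - y = (\<Sum>b\<in>B. of_int (k b - k' b) *\<^sub>R b)"
    by (simp add: sum_subtractf scaleR_left_diff_distrib)
  then show ?thesis
    unfolding L by (intro CollectI exI[of _ "\<lambda>b. k b - k' b"]) auto
qed

text \<open>
  Within distance \<open>O(N)\<close> of the origin a lattice has as many points, uniformly separated, as the
  standard integer lattice has in a cube of side \<open>N\<close>: the integer combinations of a basis with
  nonnegative coefficients below \<open>N\<close>. A linear map that carries the basis to an orthonormal one reads off the coefficients, and its
  boundedness gives the separation.
\<close>

lemma lattice_grid:
  fixes L :: "'a::euclidean_space set"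
  assumes "lattice L"
  obtains K r :: real where "K > 0" "r > 0"
    "\<And>N::nat. \<exists>S\<subseteq>L. finite S \<and> card S = N ^ DIM('a) \<and> (\<forall>l\<in>S. norm l \<le> K * N) \<and>
       (\<forall>l\<in>S. \<forall>m\<in>S. l \<noteq> m \<longrightarrow> r \<le> dist l m)"
proof -
  obtain B where B: "independent B" "span B = UNIV"
    and L: "L = {\<Sum>b\<in>B. of_int (k b) *\<^sub>R b | k :: 'a \<Rightarrow> int. True}"
    using assms unfolding lattice_def by blast
  have fin: "finite B"
    using B(1) by (rule independent_imp_finite)
  have card: "card B = DIM('a)"
    using dim_span_eq_card_independent[OF B(1)] B(2) by simp
  obtain f where f: "bij_betw f B (Basis :: 'a set)"
    using fin card finite_same_card_bij[of B "Basis :: 'a set"] by auto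
  obtain h where h: "linear h" "\<And>b. b \<in> B \<Longrightarrow> h b = f b"
    using linear_independent_extend[OF B(1), of f] by blast
  obtain K where K: "K > 0" "\<And>x. norm (h x) \<le> K * norm x"
    using linear_bounded_pos[OF h(1)] by blast
  define point where "point k = (\<Sum>b\<in>B. of_int (k b) *\<^sub>R b)" for k :: "'a \<Rightarrow> int"
  have coord: "h (point k) \<bullet> f b = of_int (k b)" if "b \<in> B" for k b
  proof -
    have "h (point k) \<bullet> f b = (\<Sum>b'\<in>B. of_int (k b') * (f b' \<bullet> f b))"
      unfolding point_def by (simp add: linear_sum[OF h(1)] linear_scale[OF h(1)] inner_sum_left h(2))
    also have "\<dots> = (\<Sum>b'\<in>B. if b' = b then of_int (k b') else 0)"
    proof (rule sum.cong)
      fix b' assume "b' \<in> B"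
      then have "f b' \<in> Basis" "f b \<in> Basis" "f b' = f b \<longleftrightarrow> b' = b"
        using that f by (auto simp: bij_betw_def inj_on_def)
      then show "real_of_int (k b') * (f b' \<bullet> f b) = (if b' = b then of_int (k b') else 0)"
        by (simp add: inner_Basis)
    qed simp
    finally show ?thesis
      using that fin by simp
  qed
  have sep: "1 / K \<le> dist (point k) (point k')" if "b \<in> B" "k b \<noteq> k' b" for k k' b
  proof -
    have "1 \<le> \<bar>real_of_int (k b) - of_int (k' b)\<bar>"
      using that(2) by linarith
    also have "\<dots> = \<bar>h (point k - point k') \<bullet> f b\<bar>"
      using that(1) by (simp add: linear_diff[OF h(1)] inner_diff_left coord)
    also have "\<dots> \<le> norm (h (point k - point k'))"
      using that(1) f by (intro Basis_le_norm) (auto simp: bij_betw_def)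
    also have "\<dots> \<le> K * dist (point k) (point k')"
      using K(2) by (simp add: dist_norm)
    finally show ?thesis
      using K(1) by (simp add: field_simps)
  qed
  define M where "M = (\<Sum>b\<in>B. norm b) + 1"
  have "M > 0"
    unfolding M_def by (smt (verit) norm_ge_zero sum_nonneg)
  moreover have "\<exists>S\<subseteq>L. finite S \<and> card S = N ^ DIM('a) \<and> (\<forall>l\<in>S. norm l \<le> M * N) \<and>
       (\<forall>l\<in>S. \<forall>m\<in>S. l \<noteq> m \<longrightarrow> 1 / K \<le> dist l m)" for N :: nat
  proof (intro exI conjI)
    let ?P = "PiE B (\<lambda>_. {0..<int N})"
    show "point ` ?P \<subseteq> L"
      unfolding L point_def by blast
    show "finite (point ` ?P)"
      using fin by (intro finite_imageI finite_PiE) auto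
    have inj: "inj_on point ?P"
    proof (rule inj_onI, rule PiE_ext)
      fix k k' b assume "point k = point k'" "b \<in> B"
      then show "k b = k' b"
        using coord[of b k] coord[of b k'] by simp
    qed
    show "card (point ` ?P) = N ^ DIM('a)"
      using fin by (simp add: card_image[OF inj] card_PiE card)
    show "\<forall>l\<in>point ` ?P. norm l \<le> M * N"
    proof safe
      fix k assume k: "k \<in> ?P"
      have "norm (point k) \<le> (\<Sum>b\<in>B. N * norm b)"
        unfolding point_def
      proof (rule sum_norm_le)
        fix b assume "b \<in> B"
        then have "\<bar>real_of_int (k b)\<bar> \<le> N"
          using k by (smt (verit, best) PiE_mem atLeastLessThan_iff of_int_of_nat_eq of_int_less_iff of_int_0_le_iff)
        then show "norm (real_of_int (k b) *\<^sub>R b) \<le> N * norm b"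
          by (simp add: mult_right_mono)
      qed
      also have "\<dots> \<le> M * N"
        by (simp add: M_def sum_distrib_left[symmetric] algebra_simps)
      finally show "norm (point k) \<le> M * N" .
    qed
    show "\<forall>l\<in>point ` ?P. \<forall>m\<in>point ` ?P. l \<noteq> m \<longrightarrow> 1 / K \<le> dist l m"
    proof safe
      fix k k' assume "k \<in> ?P" "k' \<in> ?P" "point k \<noteq> point k'"
      then obtain b where "b \<in> B" "k b \<noteq> k' b"
        by (metis PiE_ext)
      then show "1 / K \<le> dist (point k) (point k')"
        by (rule sep)
    qed
  qed
  ultimately show ?thesis
    using K(1) by (intro that[where K = M and r = "1 / K"]) simp_all
qed

lemma continuous_integrable_on_bounded:
  fixes g :: "'a::euclidean_space \<Rightarrow> real"
  assumes "continuous_on UNIV g" "S \<in> sets lebesgue" "bounded S"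
  shows "g integrable_on S"
proof -
  obtain a b where ab: "S \<subseteq> cbox a b"
    using assms(3) bounded_subset_cbox_symmetric by blast
  have "g absolutely_integrable_on cbox a b"
    using assms(1) continuous_on_subset by (intro absolutely_integrable_continuous) blast
  then have "g absolutely_integrable_on S"
    using set_integrable_subset[OF _ _ ab] assms(2) by blast
  then show ?thesis
    using set_lebesgue_integral_eq_integral(1) by blast
qed

text \<open>
  The growth hypothesis bounds the integral over a ball by the volume of a shell of width one, which
  is quadratic in the radius. If \<open>g\<close> were positive at \<open>x\<close>, it would be bounded below by some
  \<open>c > 0\<close> on the translates by lattice points of a small ball around \<open>x\<close>. A ball of radius \<open>O(N)\<close>
  contains \<open>N\<^sup>3\<close> disjoint translates, a cubic lower bound. Working with large balls replaces
  integration over a fundamental domain.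
\<close>

lemma periodic_nonneg_small_growth_eq_0:
  fixes L :: "(real^3) set" and g :: "real^3 \<Rightarrow> real"
  assumes "lattice L" and cont: "continuous_on UNIV g" and nonneg: "\<And>p. g p \<ge> 0"
    and periodic: "\<And>p l. l \<in> L \<Longrightarrow> g (p + l) = g p"
    and growth: "\<And>x R. R > 0 \<Longrightarrow>
      integral (cball x R) g \<le> measure lebesgue (cball x (R + 1)) - measure lebesgue (cball x R)"
  shows "g x = 0"
proof (rule ccontr)
  assume "g x \<noteq> 0"
  define c where "c = g x / 2"
  have c: "c > 0"
    using \<open>g x \<noteq> 0\<close> nonneg[of x] by (simp add: c_def)
  have "isCont g x"
    using cont continuous_on_eq_continuous_at by blast
  then obtain s where s: "s > 0" "\<And>y. dist y x < s \<Longrightarrow> dist (g y) (g x) < c"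
    using c unfolding continuous_at_eps_delta dist_norm real_norm_def by metis
  obtain K r :: real where K: "K > 0" and r: "r > 0" and grid:
    "\<And>N::nat. \<exists>S\<subseteq>L. finite S \<and> card S = N ^ DIM(real^3) \<and> (\<forall>l\<in>S. norm l \<le> K * N) \<and>
       (\<forall>l\<in>S. \<forall>m\<in>S. l \<noteq> m \<longrightarrow> r \<le> dist l m)"
    using lattice_grid[OF assms(1)] by blast
  \<comment> \<open>Small enough for \<open>g \<ge> c\<close> on the ball around \<open>x\<close>, and for its translates to be disjoint.\<close>
  define \<rho> where "\<rho> = min s (r / 2)"
  have \<rho>: "\<rho> > 0" "\<rho> \<le> s" "2 * \<rho> \<le> r"
    using s(1) r by (auto simp: \<rho>_def)
  have large: "g y \<ge> c" if "y \<in> ball (x + l) \<rho>" "l \<in> L" for y l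
  proof -
    have "dist (y - l) x < s"
      using that(1) \<rho>(2) by (auto simp: dist_norm norm_minus_commute algebra_simps)
    from s(2)[OF this] have "g (y - l) \<ge> c"
      unfolding dist_real_def c_def by linarith
    moreover have "g (y - l) = g y"
      using periodic[OF that(2), of "y - l"] by simp
    ultimately show ?thesis by simp
  qed
  define a where "a = c * measure lebesgue (ball (0::real^3) \<rho>)"
  \<comment> \<open>With \<open>b \<ge> 1\<close> the radius \<open>R = b N\<close> is at least one, so that \<open>(R + 1)\<^sup>3 - R\<^sup>3 \<le> 7 R\<^sup>2\<close>.\<close>
  define b where "b = K + \<rho> + 1"
  define V where "V = unit_ball_vol 3"
  have a: "a > 0"
    using c \<rho>(1) by (simp add: a_def)
  have ball_content: "measure lebesgue (cball y R) = V * R ^ 3" if "R \<ge> 0" for y :: "real^3" and R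
    using that by (simp add: content_cball V_def)
  have bound: "N ^ 3 * a \<le> 7 * V * b\<^sup>2 * N\<^sup>2" if "N \<ge> 1" for N :: nat
  proof -
    define R where "R = b * N"
    have "b \<ge> 1"
      using K \<rho>(1) by (simp add: b_def)
    have R1: "R \<ge> 1"
      using \<open>b \<ge> 1\<close> that unfolding R_def by (metis mult_mono mult_1 of_nat_1 of_nat_le_iff order_trans zero_le_one)
    have RN: "K * N + \<rho> \<le> R"
    proof -
      have "\<rho> * 1 \<le> \<rho> * N" using \<rho>(1) that by (intro mult_left_mono) auto
      then show ?thesis by (simp add: R_def b_def algebra_simps)
    qed
    obtain S where S: "S \<subseteq> L" "finite S" "card S = N ^ 3" "\<And>l. l \<in> S \<Longrightarrow> norm l \<le> K * N"
      "\<And>l m. l \<in> S \<Longrightarrow> m \<in> S \<Longrightarrow> l \<noteq> m \<Longrightarrow> r \<le> dist l m"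
      using grid[of N] by auto
    define U where "U = (\<Union>l\<in>S. ball (x + l) \<rho>)"
    have "measure lebesgue U = (\<Sum>l\<in>S. measure lebesgue (ball (x + l) \<rho>))"
      unfolding U_def
    proof (rule measure_UNION')
      show "pairwise (\<lambda>l m. disjnt (ball (x + l) \<rho>) (ball (x + m) \<rho>)) S"
      proof (intro pairwiseI)
        fix l m assume "l \<in> S" "m \<in> S" "l \<noteq> m"
        then have "2 * \<rho> \<le> dist (x + l) (x + m)"
          using S(5) \<rho>(3) by fastforce
        then show "disjnt (ball (x + l) \<rho>) (ball (x + m) \<rho>)"
          unfolding disjnt_def by (intro disjoint_ballI) auto
      qed
    qed (use S(2) in auto)
    also have "\<dots> = N ^ 3 * measure lebesgue (ball (0::real^3) \<rho>)"
      using S(3) \<rho>(1) by (simp add: content_ball)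
    finally have "N ^ 3 * a = c * measure lebesgue U"
      by (simp add: a_def)
    also have Um: "U \<in> lmeasurable"
      unfolding U_def using S(2) by (intro fmeasurable.finite_UN) auto
    then have "c * measure lebesgue U = integral U (\<lambda>_. c)"
      by (simp add: lmeasure_integral flip: integral_mult_right)
    also have UR: "U \<subseteq> cball x R"
    proof
      fix y assume "y \<in> U"
      then obtain l where l: "l \<in> S" "dist (x + l) y < \<rho>"
        by (auto simp: U_def)
      have "dist x y \<le> norm l + dist (x + l) y"
        using dist_triangle[of x y "x + l"] by (simp add: dist_norm)
      then show "y \<in> cball x R"
        using l S(4)[of l] RN by simp
    qed
    then have gi: "g integrable_on U" "g integrable_on cball x R"
      using Um bounded_subset[OF bounded_cball UR]
      by (auto intro!: continuous_integrable_on_bounded cont fmeasurableD)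
    have "integral U (\<lambda>_. c) \<le> integral U g"
      using Um gi large S(1) by (intro integral_le) (auto simp: U_def integrable_on_const)
    also have "\<dots> \<le> integral (cball x R) g"
      using gi UR nonneg by (intro integral_subset_le) auto
    also have "\<dots> \<le> V * (R + 1) ^ 3 - V * R ^ 3"
      using growth[of R x] R1 ball_content[of R x] ball_content[of "R + 1" x] by simp
    also have "\<dots> = V * (3 * R\<^sup>2 + 3 * R + 1)"
      by (simp add: algebra_simps power2_eq_square power3_eq_cube)
    also have "\<dots> \<le> V * (7 * R\<^sup>2)"
    proof (rule mult_left_mono)
      have "R \<le> R\<^sup>2" "1 \<le> R\<^sup>2"
        using R1 by (simp_all add: power2_eq_square mult_le_cancel_left1) (metis R1 mult_mono mult_1 order_trans zero_le_one)
      then show "3 * R\<^sup>2 + 3 * R + 1 \<le> 7 * R\<^sup>2" by linarith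
    qed (simp add: V_def)
    finally show ?thesis
      by (simp add: R_def power_mult_distrib algebra_simps)
  qed
  obtain N :: nat where N: "N > 7 * V * b\<^sup>2 / a" "N \<ge> 1"
    by (metis reals_Archimedean2 less_le_trans of_nat_le_iff max.cobounded1 max.cobounded2)
  have "N * a \<le> 7 * V * b\<^sup>2"
    using bound[OF N(2)] N(2) by (simp add: power2_eq_square power3_eq_cube mult.assoc)
  then show False
    using N(1) a by (simp add: field_simps)
qed

section \<open>Vector fields with straight integral curves\<close>

lemma gronwall_zero:
  fixes g :: "real \<Rightarrow> real"
  assumes "\<And>t. (g has_real_derivative g' t) (at t)" "\<And>t. 0 \<le> t \<Longrightarrow> t \<le> T \<Longrightarrow> g' t \<le> K * g t"
    and "g 0 = 0" "0 \<le> T"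
  shows "g T \<le> 0"
proof -
  have "exp (- K * T) * g T \<le> exp (- K * 0) * g 0"
  proof (rule DERIV_nonpos_imp_nonincreasing[OF assms(4)])
    fix t assume t: "0 \<le> t" "t \<le> T"
    have "DERIV (\<lambda>t. exp (- K * t) * g t) t :> exp (- K * t) * (g' t - K * g t)"
      by (auto intro!: derivative_eq_intros assms(1) simp: algebra_simps)
    moreover have "exp (- K * t) * (g' t - K * g t) \<le> 0"
      using assms(2)[OF t] by (intro mult_nonneg_nonpos) auto
    ultimately show "\<exists>y. DERIV (\<lambda>t. exp (- K * t) * g t) t :> y \<and> y \<le> 0"
      by blast
  qed
  then show ?thesis
    using assms(3) by (simp add: mult_le_0_iff)
qed

text \<open>
  The hypothesis differentiates \<open>Z\<close> at a point \<open>q\<close> in direction \<open>Z q\<close>, whereas the line through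
  \<open>p\<close> has direction \<open>Z p\<close>. The discrepancy is controlled by the quantity to be estimated: the
  derivative of \<open>|Z q - Z p|\<^sup>2\<close> along the line is at most a constant times \<open>|Z q - Z p|\<^sup>2\<close>. Gronwall's
  inequality then gives zero, without any existence theorem for integral curves. Scaling the line
  by \<open>t\<close> reduces both signs of \<open>t\<close> to the parameter interval \<open>{0..1}\<close>.
\<close>

lemma constant_along_geodesic_lines:
  fixes Z :: "'a::euclidean_space \<Rightarrow> 'a"
  assumes "smooth Z" and geo: "\<And>p. dirderiv (Z p) Z p = 0"
  shows "Z (p + t *\<^sub>R Z p) = Z p"
proof -
  define v where "v = t *\<^sub>R Z p"
  define \<gamma> where "\<gamma> s = p + s *\<^sub>R v" for s
  have diff: "Z differentiable (at q)" for q
    by (intro smooth_differentiable assms)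
  have "compact (\<gamma> ` {0..1})"
    unfolding \<gamma>_def by (intro compact_continuous_image continuous_intros) auto
  then obtain K where K: "K > 0" "\<And>w q. q \<in> \<gamma> ` {0..1} \<Longrightarrow> norm (dirderiv w Z q) \<le> K * norm w"
    using dirderiv_bounded_on_compact[OF assms(1)] by blast
  have diff2: "(\<lambda>q. Z q - Z p) differentiable (at q)" for q
    by (intro differentiable_diff diff differentiable_const)
  define g where "g s = (Z (\<gamma> s) - Z p) \<bullet> (Z (\<gamma> s) - Z p)" for s
  have dg: "(g has_real_derivative 2 * ((Z (\<gamma> s) - Z p) \<bullet> dirderiv v Z (\<gamma> s))) (at s)" for s
  proof -
    have "(\<lambda>q. (Z q - Z p) \<bullet> (Z q - Z p)) differentiable (at (p + s *\<^sub>R v))"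
      using has_derivative_inner diff2 unfolding differentiable_def by fast
    from has_real_derivative_along_line[OF this]
    have "(g has_real_derivative dirderiv v (\<lambda>q. (Z q - Z p) \<bullet> (Z q - Z p)) (\<gamma> s)) (at s)"
      by (simp add: g_def[abs_def] \<gamma>_def)
    moreover have "dirderiv v (\<lambda>q. Z q - Z p) (\<gamma> s) = dirderiv v Z (\<gamma> s)"
      by (rule dirderiv_eqI[THEN trans]) (auto intro!: derivative_eq_intros has_derivative_dirderiv diff)
    ultimately show ?thesis
      by (simp add: dirderiv_inner diff2 inner_commute)
  qed
  have "g 1 \<le> 0"
  proof (rule gronwall_zero[OF dg])
    fix s :: real assume s: "0 \<le> s" "s \<le> 1"
    let ?w = "Z (\<gamma> s) - Z p"
    have lin: "linear (\<lambda>w. dirderiv w Z (\<gamma> s))"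
      by (intro linear_dirderiv diff)
    \<comment> \<open>The derivative in the field's own direction vanishes, so \<open>Z p\<close> may be traded for \<open>Z p - Z (\<gamma> s)\<close>.\<close>
    have "dirderiv v Z (\<gamma> s) = - t *\<^sub>R dirderiv ?w Z (\<gamma> s)"
      using geo[of "\<gamma> s"] by (simp add: v_def linear_scale[OF lin] linear_diff[OF lin])
    then have "2 * (?w \<bullet> dirderiv v Z (\<gamma> s)) \<le> 2 * \<bar>t\<bar> * \<bar>?w \<bullet> dirderiv ?w Z (\<gamma> s)\<bar>"
      by (simp add: abs_mult[symmetric])
    also have "\<dots> \<le> 2 * \<bar>t\<bar> * (norm ?w * norm (dirderiv ?w Z (\<gamma> s)))"
      by (intro mult_left_mono Cauchy_Schwarz_ineq2) auto
    also have "\<dots> \<le> 2 * \<bar>t\<bar> * (norm ?w * (K * norm ?w))"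
      using s by (intro mult_left_mono K(2)) auto
    also have "\<dots> = 2 * \<bar>t\<bar> * K * g s"
      by (simp add: g_def dot_square_norm power2_eq_square)
    finally show "2 * (?w \<bullet> dirderiv v Z (\<gamma> s)) \<le> 2 * \<bar>t\<bar> * K * g s" .
  qed (auto simp: g_def \<gamma>_def)
  then have "(Z (\<gamma> 1) - Z p) \<bullet> (Z (\<gamma> 1) - Z p) = 0"
    unfolding g_def by (meson inner_ge_zero order_antisym)
  then show ?thesis
    by (simp add: \<gamma>_def v_def)
qed

text \<open>
  The second elementary symmetric function of the eigenvalues, as the sum of the principal minors.
\<close>

definition minors2 :: "real^3^3 \<Rightarrow> real" where
  "minors2 A = A$1$1 * A$2$2 - A$1$2 * A$2$1 + (A$1$1 * A$3$3 - A$1$3 * A$3$1)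
     + (A$2$2 * A$3$3 - A$2$3 * A$3$2)"

lemma det_id_plus_scaled:
  fixes A :: "real^3^3"
  shows "det (mat 1 + t *\<^sub>R A) = 1 + t * trace A + t\<^sup>2 * minors2 A + t ^ 3 * det A"
  by (simp add: det_3 trace_def sum_3 minors2_def mat_def power2_eq_square power3_eq_cube algebra_simps)

lemma quadratic_without_real_zero:
  fixes \<tau> \<delta> :: real
  assumes "\<And>t. 1 + t * \<tau> + t\<^sup>2 * \<delta> \<noteq> 0"
  shows "\<tau> = 0 \<and> \<delta> = 0 \<or> \<tau>\<^sup>2 < 4 * \<delta>"
proof (cases "\<delta> = 0")
  case True
  then show ?thesis
    using assms[of "- 1 / \<tau>"] by (cases "\<tau> = 0") auto
next
  case False
  show ?thesis
  proof (rule ccontr)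
    assume "\<not> ?thesis"
    then have nn: "\<tau>\<^sup>2 - 4 * \<delta> \<ge> 0" by linarith
    define w where "w = sqrt (\<tau>\<^sup>2 - 4 * \<delta>)"
    have w: "w\<^sup>2 = \<tau>\<^sup>2 - 4 * \<delta>"
      using nn by (simp add: w_def)
    define t where "t = (w - \<tau>) / (2 * \<delta>)"
    have "2 * \<delta> * t = w - \<tau>"
      using False by (simp add: t_def)
    moreover have "4 * \<delta> * (1 + t * \<tau> + t\<^sup>2 * \<delta>) = (2 * \<delta> * t + \<tau>)\<^sup>2 - (\<tau>\<^sup>2 - 4 * \<delta>)"
      by (simp add: power2_eq_square algebra_simps)
    ultimately have "4 * \<delta> * (1 + t * \<tau> + t\<^sup>2 * \<delta>) = 0"
      using w by simp
    then show False
      using False assms[of t] by simp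
  qed
qed

definition jacobian :: "(real^3 \<Rightarrow> real^3) \<Rightarrow> real^3 \<Rightarrow> real^3^3" where
  "jacobian Z p = matrix (\<lambda>v. dirderiv v Z p)"

lemma jacobian_nth: "jacobian Z p $ i $ j = dirderiv (axis j 1) Z p $ i"
  by (simp add: jacobian_def matrix_def)

text \<open>
  The map \<open>q \<mapsto> q + t Z q\<close> has the left inverse \<open>q \<mapsto> q - t Z q\<close>, so its derivative is injective and
  its determinant is nonzero for every real \<open>t\<close>. The determinant is only quadratic in \<open>t\<close> because
  \<open>DZ\<close> is singular: it kills \<open>Z\<close>.
\<close>

lemma geodesic_jacobian:
  fixes Z :: "real^3 \<Rightarrow> real^3"
  assumes "smooth Z" and geo: "\<And>p. dirderiv (Z p) Z p = 0" and nz: "Z p \<noteq> 0"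
  shows "trace (jacobian Z p) = 0 \<and> minors2 (jacobian Z p) = 0
      \<or> (trace (jacobian Z p))\<^sup>2 < 4 * minors2 (jacobian Z p)"
    and "det (matrix (\<lambda>v. v + t *\<^sub>R dirderiv v Z p))
      = 1 + t * trace (jacobian Z p) + t\<^sup>2 * minors2 (jacobian Z p)"
proof -
  let ?f = "\<lambda>t q. q + t *\<^sub>R Z q" and ?f' = "\<lambda>t q v. v + t *\<^sub>R dirderiv v Z q"
  have diff: "Z differentiable (at q)" for q
    by (intro smooth_differentiable assms)
  have der: "(?f t has_derivative ?f' t q) (at q)" for t q
    by (auto intro!: derivative_eq_intros has_derivative_dirderiv diff)
  have lin: "linear (?f' t q)" for t q
    using der has_derivative_linear by blast
  have inj: "inj (?f' t p)" for t
  proof -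
    have "?f (- t) (?f t q) = q" for q
      using constant_along_geodesic_lines[OF assms(1) geo, of q t] by simp
    then have "((\<lambda>q. q) has_derivative ?f' (- t) (?f t p) \<circ> ?f' t p) (at p)"
      using diff_chain_at[OF der[of t p] der[of "- t" "?f t p"]] by (simp only: o_def)
    then have "?f' (- t) (?f t p) \<circ> ?f' t p = (\<lambda>v. v)"
      using has_derivative_unique has_derivative_ident by blast
    from fun_cong[OF this] have "?f' (- t) (?f t p) (?f' t p v) = v" for v
      by (simp only: o_def)
    then show ?thesis
      by (rule inj_on_inverseI)
  qed
  have "\<not> inj (\<lambda>v. dirderiv v Z p)"
  proof
    assume "inj (\<lambda>v. dirderiv v Z p)"
    moreover have "dirderiv (Z p) Z p = dirderiv 0 Z p"
      using geo[of p] linear_0[OF linear_dirderiv[OF diff[of p]]] by simp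
    ultimately show False
      using nz by (auto dest: injD)
  qed
  then have "det (jacobian Z p) = 0"
    using det_nz_iff_inj[OF linear_dirderiv[OF diff[of p]]] by (simp add: jacobian_def)
  moreover have "matrix (?f' t p) = mat 1 + t *\<^sub>R jacobian Z p" for t
    by (simp add: vec_eq_iff jacobian_nth matrix_def mat_def axis_def)
  ultimately have det: "det (matrix (?f' t p)) = 1 + t * trace (jacobian Z p) + t\<^sup>2 * minors2 (jacobian Z p)" for t
    by (simp add: det_id_plus_scaled)
  then have "1 + t * trace (jacobian Z p) + t\<^sup>2 * minors2 (jacobian Z p) \<noteq> 0" for t
    using det_nz_iff_inj[OF lin, of t p] inj[of t] by simp
  from quadratic_without_real_zero[OF this]
  show "trace (jacobian Z p) = 0 \<and> minors2 (jacobian Z p) = 0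
      \<or> (trace (jacobian Z p))\<^sup>2 < 4 * minors2 (jacobian Z p)" .
  show "det (matrix (?f' t p)) = 1 + t * trace (jacobian Z p) + t\<^sup>2 * minors2 (jacobian Z p)"
    by (rule det)
qed

section \<open>Volume and the vanishing of divergence and second minors\<close>

lemma continuous_on_trace_minors2:
  assumes "smooth Z"
  shows "continuous_on UNIV (\<lambda>p. trace (jacobian Z p))"
    and "continuous_on UNIV (\<lambda>p. minors2 (jacobian Z p))"
  unfolding trace_def minors2_def jacobian_nth sum_3
  by (intro continuous_intros smooth_continuous_on smooth_dirderiv assms)+

text \<open>
  Moving every point \<open>q\<close> by the unit vector \<open>t Z q\<close> maps the ball injectively into the ball of radius
  one larger, and the integrand is the Jacobian determinant of this map. It needs no absolute value,
  since a quadratic polynomial in \<open>t\<close> without real zeros and with value one at \<open>t = 0\<close> is positive.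
\<close>

lemma geodesic_flow_volume_bound:
  fixes Z :: "real^3 \<Rightarrow> real^3"
  assumes "smooth Z" and unit: "\<And>p. norm (Z p) = 1" and geo: "\<And>p. dirderiv (Z p) Z p = 0"
    and "R > 0" and t: "\<bar>t\<bar> = 1"
  shows "integral (cball x R) (\<lambda>p. 1 + t * trace (jacobian Z p) + minors2 (jacobian Z p))
    \<le> measure lebesgue (cball x (R + 1))"
proof -
  let ?f = "\<lambda>q. q + t *\<^sub>R Z q" and ?f' = "\<lambda>q v. v + t *\<^sub>R dirderiv v Z q"
  let ?S = "cball x R"
  have t2: "t\<^sup>2 = 1"
    using t by (metis one_power2 power2_abs)
  have nz: "Z q \<noteq> 0" for q
    by (metis norm_zero unit zero_neq_one)
  have der: "(?f has_derivative ?f' q) (at q within ?S)" for q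
    by (rule has_derivative_at_withinI, intro has_derivative_add has_derivative_ident
        has_derivative_scaleR_right has_derivative_dirderiv smooth_differentiable assms(1))
  have inj: "inj_on ?f ?S"
    by (rule inj_on_inverseI[where g = "\<lambda>q. q - t *\<^sub>R Z q"])
       (simp add: constant_along_geodesic_lines[OF assms(1) geo])
  have det: "\<bar>det (matrix (?f' q))\<bar> = 1 + t * trace (jacobian Z q) + minors2 (jacobian Z q)" for q
  proof -
    let ?\<tau> = "trace (jacobian Z q)" and ?\<delta> = "minors2 (jacobian Z q)"
    note cases = geodesic_jacobian[OF assms(1) geo nz, where p = q]
    have "0 \<le> 1 + t * ?\<tau> + ?\<delta>"
    proof (cases "?\<tau>\<^sup>2 < 4 * ?\<delta>")
      case True
      have "(2 * ?\<delta> + t * ?\<tau>)\<^sup>2 + (4 * ?\<delta> - ?\<tau>\<^sup>2) = 4 * ?\<delta> * (1 + t * ?\<tau> + ?\<delta>)"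
        using t2 by (simp add: power2_eq_square algebra_simps)
      then have "0 < 4 * ?\<delta> * (1 + t * ?\<tau> + ?\<delta>)"
        using True by (smt (verit) zero_le_power2)
      moreover have "?\<delta> > 0"
        using True by (smt (verit) zero_le_power2)
      ultimately show ?thesis
        by (simp add: zero_less_mult_iff)
    qed (use cases(1) in auto)
    then show ?thesis
      using cases(2)[of t] t2 by simp
  qed
  have int: "(\<lambda>q. \<bar>det (matrix (?f' q))\<bar>) integrable_on ?S"
    unfolding det
    by (intro continuous_integrable_on_bounded continuous_intros continuous_on_trace_minors2 assms) auto
  have meas: "?f ` ?S \<in> lmeasurable"
    using measurable_differentiable_image_eq[OF _ der inj] int by auto
  have "?f ` ?S \<subseteq> cball x (R + 1)"
  proof safe
    fix q assume "q \<in> ?S"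
    moreover have "dist x (?f q) \<le> dist x q + dist q (?f q)"
      by (rule dist_triangle)
    ultimately show "?f q \<in> cball x (R + 1)"
      using unit[of q] t by (simp add: dist_norm)
  qed
  then have "measure lebesgue (?f ` ?S) \<le> measure lebesgue (cball x (R + 1))"
    using meas by (intro measure_mono_fmeasurable) (auto simp: fmeasurableD)
  then show ?thesis
    using measure_differentiable_image_eq[OF _ der inj int] by (simp add: det)
qed

lemma jacobian_translate:
  assumes "smooth Z" and "\<And>q. Z (q + l) = Z q"
  shows "jacobian Z (p + l) = jacobian Z p"
proof -
  have "((\<lambda>q. q + l) has_derivative (\<lambda>v. v)) (at p)"
    by (auto intro!: derivative_eq_intros)
  from diff_chain_at[OF this has_derivative_dirderiv[OF smooth_differentiable[OF assms(1)]]]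
  have "(Z has_derivative (\<lambda>v. dirderiv v Z (p + l))) (at p)"
    by (simp add: o_def assms(2))
  then show ?thesis
    unfolding jacobian_def by (simp add: dirderiv_eqI)
qed

text \<open>
  In the sum of the volume bounds for \<open>t = 1\<close> and \<open>t = -1\<close> the trace cancels. What is left bounds the
  growth of the integral of the nonnegative, lattice-periodic function \<open>\<delta>\<close>.
\<close>

lemma geodesic_trace_minors2_eq_0:
  fixes Z :: "real^3 \<Rightarrow> real^3"
  assumes "lattice L" and periodic: "\<And>l q. l \<in> L \<Longrightarrow> Z (q + l) = Z q"
    and "smooth Z" and unit: "\<And>p. norm (Z p) = 1" and geo: "\<And>p. dirderiv (Z p) Z p = 0"
  shows "minors2 (jacobian Z p) = 0" and "trace (jacobian Z p) = 0"
proof -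
  let ?\<tau> = "\<lambda>p. trace (jacobian Z p)" and ?\<delta> = "\<lambda>p. minors2 (jacobian Z p)"
  have nz: "Z q \<noteq> 0" for q
    by (metis norm_zero unit zero_neq_one)
  note cases = geodesic_jacobian[OF \<open>smooth Z\<close> geo nz]
  note cont = continuous_on_trace_minors2[OF \<open>smooth Z\<close>]
  show *: "?\<delta> p = 0"
  proof (rule periodic_nonneg_small_growth_eq_0[OF \<open>lattice L\<close> cont(2)])
    fix q show "?\<delta> q \<ge> 0"
      using cases(1)[of q] by (smt (verit) zero_le_power2)
  next
    fix q l assume "l \<in> L"
    then show "?\<delta> (q + l) = ?\<delta> q"
      by (simp add: jacobian_translate[OF \<open>smooth Z\<close>] periodic)
  next
    fix x :: "real^3" and R :: real assume R: "R > 0"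
    let ?S = "cball x R"
    have int: "(\<lambda>p. 1 + t * ?\<tau> p + ?\<delta> p) integrable_on ?S" "?\<delta> integrable_on ?S"
      "(\<lambda>p. 1::real) integrable_on ?S" for t
      by (intro continuous_integrable_on_bounded continuous_intros cont; simp)+
    have "2 * (measure lebesgue ?S + integral ?S ?\<delta>) = integral ?S (\<lambda>p. 2 * (1 + ?\<delta> p))"
      unfolding integral_mult_right integral_add[OF int(3) int(2)]
      by (subst lmeasure_integral) simp_all
    also have "\<dots> = integral ?S (\<lambda>p. (1 + 1 * ?\<tau> p + ?\<delta> p) + (1 + (-1) * ?\<tau> p + ?\<delta> p))"
      by (simp add: algebra_simps)
    also have "\<dots> = integral ?S (\<lambda>p. 1 + 1 * ?\<tau> p + ?\<delta> p) + integral ?S (\<lambda>p. 1 + (-1) * ?\<tau> p + ?\<delta> p)"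
      by (rule integral_add[OF int(1) int(1)])
    also have "\<dots> \<le> 2 * measure lebesgue (cball x (R + 1))"
      using geodesic_flow_volume_bound[OF \<open>smooth Z\<close> unit geo R, of 1 x]
        geodesic_flow_volume_bound[OF \<open>smooth Z\<close> unit geo R, of "-1" x] by simp
    finally show "integral ?S ?\<delta> \<le> measure lebesgue (cball x (R + 1)) - measure lebesgue ?S"
      by simp
  qed
  show "?\<tau> p = 0"
    using cases(1)[of p] * by (smt (verit) zero_le_power2)
qed

section \<open>Nilpotent derivatives in dimension three\<close>

unbundle cross3_syntax

lemma parallel_of_cross_eq_0:
  fixes z k :: "real^3"
  assumes "norm z = 1" "k \<times> z = 0"
  shows "k = (z \<bullet> k) *\<^sub>R z"
proof -
  have "z \<times> (k \<times> z) = (z \<bullet> z) *\<^sub>R k - (z \<bullet> k) *\<^sub>R z"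
    by (simp add: cross3_simps forall_3)
  then show ?thesis
    using assms by (simp add: dot_square_norm)
qed

text \<open>
  For the partial derivatives \<open>c j\<close> of a vector field this is the curl of the field; it encodes the
  skew-symmetric part of the matrix with columns \<open>c j\<close>.
\<close>

definition vec_curl :: "(3 \<Rightarrow> real^3) \<Rightarrow> real^3" where
  "vec_curl c = (\<Sum>j\<in>UNIV. axis j 1 \<times> c j)"

lemma vec_curl_components:
  "vec_curl c $ 1 = c 2 $ 3 - c 3 $ 2"
  "vec_curl c $ 2 = c 3 $ 1 - c 1 $ 3"
  "vec_curl c $ 3 = c 1 $ 2 - c 2 $ 1"
  by (simp_all add: vec_curl_def sum_3 cross_components axis_def)

text \<open>
  The columns \<open>c j\<close> play the role of the partial derivatives of a unit field with value \<open>z\<close>: they are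
  orthogonal to \<open>z\<close>, and the matrix with these columns annihilates \<open>z\<close>.
\<close>

context
  fixes z :: "real^3" and c :: "3 \<Rightarrow> real^3"
  assumes unit: "norm z = 1" and image: "\<And>j. c j \<bullet> z = 0" and kernel: "(\<Sum>j\<in>UNIV. z $ j *\<^sub>R c j) = 0"
    and minors: "minors2 (\<chi> i j. c j $ i) = 0"
begin

private lemma kernel_components: "z $ 1 * c 1 $ i + z $ 2 * c 2 $ i + z $ 3 * c 3 $ i = 0"
  using arg_cong[OF kernel, of "\<lambda>x. x $ i"] by (simp add: sum_3)

private lemma image_components: "c j $ 1 * z $ 1 + c j $ 2 * z $ 2 + c j $ 3 * z $ 3 = 0"
  using image[of j] by (simp add: inner_vec_def sum_3)

text \<open>
  Both the matrix and its transpose annihilate \<open>z\<close>, hence so does its skew-symmetric part, which is the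
  cross product with the curl.
\<close>

lemma vec_curl_parallel: "vec_curl c = (z \<bullet> vec_curl c) *\<^sub>R z"
proof (rule parallel_of_cross_eq_0[OF unit])
  show "vec_curl c \<times> z = 0"
    using kernel_components[of 1] kernel_components[of 2] kernel_components[of 3]
      image_components[of 1] image_components[of 2] image_components[of 3]
    by (simp add: vec_eq_iff forall_3 cross_components vec_curl_components algebra_simps)
qed

text \<open>
  With \<open>A\<close> the matrix of columns \<open>c j\<close>, the squared length of the curl is \<open>|A|\<^sup>2 - tr (A\<^sup>2)\<close>, and
  \<open>tr (A\<^sup>2)\<close> is determined by the trace and the principal minors, which vanish.
\<close>

lemma sum_norm_eq_curl_sq:
  assumes trace: "c 1 $ 1 + c 2 $ 2 + c 3 $ 3 = 0"
  shows "(\<Sum>j\<in>UNIV. c j \<bullet> c j) = (z \<bullet> vec_curl c)\<^sup>2"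
proof -
  have "vec_curl c \<bullet> vec_curl c = (\<Sum>j\<in>UNIV. c j \<bullet> c j)
      - ((c 1 $ 1 + c 2 $ 2 + c 3 $ 3)\<^sup>2 - 2 * minors2 (\<chi> i j. c j $ i))"
    by (simp add: inner_vec_def sum_3 vec_curl_components minors2_def power2_eq_square algebra_simps)
  then have "(\<Sum>j\<in>UNIV. c j \<bullet> c j) = vec_curl c \<bullet> vec_curl c"
    using trace minors by simp
  also have "\<dots> = ((z \<bullet> vec_curl c) *\<^sub>R z) \<bullet> ((z \<bullet> vec_curl c) *\<^sub>R z)"
    using vec_curl_parallel by simp
  also have "\<dots> = (z \<bullet> vec_curl c)\<^sup>2"
    using unit by (simp add: dot_square_norm power2_eq_square)
  finally show ?thesis .
qed

text \<open>
  The matrix has rank at most one. Columns are orthogonal to \<open>z\<close>, so their cross products are multiples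
  of \<open>z\<close>; collect the three factors in the vector \<open>k\<close>. The linear relation between the columns makes
  \<open>k\<close> itself a multiple of \<open>z\<close>, that is, the cofactor matrix is a multiple of \<open>z z\<^sup>T\<close>. The multiple is
  the sum of the principal minors, which is zero.
\<close>

lemma columns_cross_eq_0: "c i \<times> c j = 0"
proof -
  have par: "c i \<times> c j = (z \<bullet> (c i \<times> c j)) *\<^sub>R z" for i j
  proof (rule parallel_of_cross_eq_0[OF unit])
    have "(c i \<times> c j) \<times> z = (c i \<bullet> z) *\<^sub>R c j - (c j \<bullet> z) *\<^sub>R c i"
      by (simp add: cross3_simps forall_3)
    then show "(c i \<times> c j) \<times> z = 0"
      by (simp add: image)
  qed
  define k :: "real^3" where "k = vector [z \<bullet> (c 2 \<times> c 3), z \<bullet> (c 3 \<times> c 1), z \<bullet> (c 1 \<times> c 2)]"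
  have expand: "(\<Sum>l\<in>UNIV. z $ l *\<^sub>R c l) \<times> c j = 0" for j
    using kernel by simp
  have *: "z $ 1 * (z \<bullet> (c 1 \<times> c j)) + z $ 2 * (z \<bullet> (c 2 \<times> c j)) + z $ 3 * (z \<bullet> (c 3 \<times> c j)) = 0" for j
    using arg_cong[OF expand[of j], of "\<lambda>x. z \<bullet> x"]
    by (simp add: sum_3 cross_add_left cross_mult_left inner_add_right)
  have skew: "z \<bullet> (c 2 \<times> c 1) = - (z \<bullet> (c 1 \<times> c 2))" "z \<bullet> (c 1 \<times> c 3) = - (z \<bullet> (c 3 \<times> c 1))"
    "z \<bullet> (c 3 \<times> c 2) = - (z \<bullet> (c 2 \<times> c 3))"
    by (metis cross_skew inner_minus_right)+
  have "z $ 1 * k $ 2 = z $ 2 * k $ 1" "z $ 1 * k $ 3 = z $ 3 * k $ 1"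
    "z $ 2 * k $ 3 = z $ 3 * k $ 2"
    using *[of 1] *[of 2] *[of 3] by (simp_all add: k_def vector_3 skew)
  then have "k \<times> z = 0"
    by (simp add:  vec_eq_iff forall_3 cross_components algebra_simps)
  then have k: "k = (z \<bullet> k) *\<^sub>R z"
    using parallel_of_cross_eq_0 unit by blast
  have par_nth: "(c i \<times> c j) $ l = (z \<bullet> (c i \<times> c j)) * z $ l" for i j l
    using arg_cong[OF par[of i j], of "\<lambda>x. x $ l"] by simp
  have "z \<bullet> k = (c 2 \<times> c 3) $ 1 + (c 3 \<times> c 1) $ 2 + (c 1 \<times> c 2) $ 3"
    unfolding par_nth by (simp add: k_def inner_vec_def[of z "vector _"] sum_3 vector_3)
  also have "\<dots> = minors2 (\<chi> i j. c j $ i)"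
    by (simp add: cross_components minors2_def algebra_simps)
  finally have "k = 0"
    using k minors by simp
  then have "z \<bullet> (c 2 \<times> c 3) = 0" "z \<bullet> (c 3 \<times> c 1) = 0" "z \<bullet> (c 1 \<times> c 2) = 0"
    by (simp_all add: k_def vec_eq_iff forall_3 vector_3)
  then have zero: "c 2 \<times> c 3 = 0" "c 3 \<times> c 1 = 0" "c 1 \<times> c 2 = 0"
    using par by (metis scale_zero_left)+
  then have "c 3 \<times> c 2 = 0" "c 1 \<times> c 3 = 0" "c 2 \<times> c 1 = 0"
    by (metis cross_skew neg_equal_0_iff_equal)+
  then show ?thesis
    using zero exhaust_3[of i] exhaust_3[of j] by auto
qed

end

section \<open>The Beltrami equation and the Hessian\<close>

abbreviation D :: "3 \<Rightarrow> (real^3 \<Rightarrow> 'b::real_normed_vector) \<Rightarrow> real^3 \<Rightarrow> 'b" where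
  "D j f \<equiv> dirderiv (axis j 1) f"

lemma dirderiv_expand:
  assumes "f differentiable (at p)"
  shows "dirderiv v f p = (\<Sum>j\<in>UNIV. v $ j *\<^sub>R D j f p)"
proof -
  have lin: "linear (\<lambda>v. dirderiv v f p)"
    by (rule linear_dirderiv[OF assms])
  have "dirderiv v f p = dirderiv (\<Sum>j\<in>UNIV. v $ j *\<^sub>R axis j 1) f p"
    using basis_expansion[of v] by (simp add: scalar_mult_eq_scaleR)
  then show ?thesis
    by (simp add: linear_sum[OF lin] linear_scale[OF lin])
qed

lemma cross_right_derivative:
  assumes "f differentiable (at p)"
  shows "((\<lambda>p. a \<times> f p) has_derivative (\<lambda>v. a \<times> dirderiv v f p)) (at p)"
proof -
  have "bounded_linear (\<lambda>x. a \<times> x)"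
    using bilinear_cross by (simp add: bilinear_def linear_linear)
  then show ?thesis
    by (rule bounded_linear.has_derivative[OF _ has_derivative_dirderiv[OF assms]])
qed

definition curl :: "(real^3 \<Rightarrow> real^3) \<Rightarrow> real^3 \<Rightarrow> real^3" where
  "curl Z p = vec_curl (\<lambda>j. D j Z p)"

lemma has_derivative_curl:
  assumes "smooth Z"
  shows "(curl Z has_derivative (\<lambda>v. vec_curl (\<lambda>j. dirderiv v (D j Z) p))) (at p)"
  unfolding curl_def[abs_def] vec_curl_def
  by (intro has_derivative_sum cross_right_derivative smooth_differentiable smooth_dirderiv assms)

text \<open>
  What the volume argument leaves: with vanishing trace, second minors and determinant, the derivative
  is nilpotent at every point. The last condition is \<open>\<nabla>\<^sup>*\<nabla>Z = |\<nabla>Z|\<^sup>2Z\<close> in Euclidean coordinates.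
\<close>

locale nilpotent_harmonic_field =
  fixes Z :: "real^3 \<Rightarrow> real^3"
  assumes smooth: "smooth Z" and unit: "norm (Z p) = 1" and geodesic: "dirderiv (Z p) Z p = 0"
    and trace0: "trace (jacobian Z p) = 0" and minors0: "minors2 (jacobian Z p) = 0"
    and harmonic: "(\<Sum>j\<in>UNIV. D j (D j Z) p) = - (\<Sum>j\<in>UNIV. D j Z p \<bullet> D j Z p) *\<^sub>R Z p"
begin

lemma diff: "Z differentiable (at p)" "dirderiv v Z differentiable (at p)"
  "dirderiv v (dirderiv w Z) differentiable (at p)"
  by (intro smooth_differentiable smooth_dirderiv smooth)+

lemma inner_unit: "Z p \<bullet> Z p = 1"
  using unit by (simp add: dot_square_norm)

lemma derivative_orthogonal: "dirderiv v Z p \<bullet> Z p = 0"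
proof -
  have "dirderiv v (\<lambda>p. Z p \<bullet> Z p) p = 0"
    by (simp add: inner_unit)
  then show ?thesis
    by (simp add: dirderiv_inner diff inner_commute)
qed

lemma kernel: "(\<Sum>j\<in>UNIV. Z p $ j *\<^sub>R D j Z p) = 0"
  using dirderiv_expand[OF diff(1), of "Z p" p] geodesic by simp

lemma divergence: "D 1 Z p $ 1 + D 2 Z p $ 2 + D 3 Z p $ 3 = 0"
  using trace0[of p] by (simp add: trace_def sum_3 jacobian_nth)

lemma minors_columns: "minors2 (\<chi> i j. D j Z p $ i) = 0"
  using minors0[of p] by (simp add: minors2_def jacobian_nth)

lemmas shape = derivative_orthogonal kernel minors_columns

text \<open>
  The function with \<open>curl Z = \<mu> Z\<close>, given by an inner product so that its differentiability is clear.
\<close>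

definition \<mu> :: "real^3 \<Rightarrow> real" where
  "\<mu> p = Z p \<bullet> curl Z p"

lemma curl_eq: "curl Z p = \<mu> p *\<^sub>R Z p"
  unfolding curl_def \<mu>_def using vec_curl_parallel[OF unit shape] .

lemma energy_eq: "(\<Sum>j\<in>UNIV. D j Z p \<bullet> D j Z p) = (\<mu> p)\<^sup>2"
  unfolding curl_def \<mu>_def using sum_norm_eq_curl_sq[OF unit shape divergence] .

lemma differentiable_curl: "curl Z differentiable (at p)"
  using has_derivative_curl[OF smooth] differentiable_def by blast

lemma differentiable_\<mu>: "\<mu> differentiable (at p)"
  unfolding \<mu>_def[abs_def] by (intro differentiable_inner diff differentiable_curl)

lemma derivative_curl_eq:
  "vec_curl (\<lambda>j. dirderiv v (D j Z) p) = dirderiv v \<mu> p *\<^sub>R Z p + \<mu> p *\<^sub>R dirderiv v Z p"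
proof -
  have "vec_curl (\<lambda>j. dirderiv v (D j Z) p) = dirderiv v (curl Z) p"
    using dirderiv_eqI[OF has_derivative_curl[OF smooth]] by metis
  also have "curl Z = (\<lambda>p. \<mu> p *\<^sub>R Z p)"
    using curl_eq by blast
  finally show ?thesis
    by (simp add: dirderiv_scaleR differentiable_\<mu> diff)
qed

text \<open>
  Differentiating \<open>curl Z = \<mu> Z\<close> once more gives nine scalar equations. The left-hand
  side of their trace is \<open>div (curl Z) = 0\<close>, so the gradient \<open>g\<close> of \<open>\<mu>\<close> is orthogonal to \<open>Z\<close>, as \<open>div Z = 0\<close>. Their
  skew-symmetric part computes \<open>curl (curl Z) = g \<times> Z + \<mu>\<^sup>2 Z\<close>; as \<open>div Z = 0\<close>, the left-hand side is
  \<open>- \<Delta> Z = \<mu>\<^sup>2 Z\<close>, so \<open>g\<close> is parallel to \<open>Z\<close>.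
\<close>

lemma \<mu>_derivative_zero: "dirderiv v \<mu> p = 0"
proof -
  define g :: "real^3" where "g = (\<chi> i. D i \<mu> p)"
  define H where "H i j = D i (D j Z) p" for i j
  have sym: "H 2 1 = H 1 2" "H 3 1 = H 1 3" "H 3 2 = H 2 3"
    unfolding H_def using dirderiv_commute[OF smooth] by metis+
  have eq: "vec_curl (H i) $ l = g $ i * Z p $ l + \<mu> p * D i Z p $ l" for i l
    using arg_cong[OF derivative_curl_eq[of "axis i 1" p], of "\<lambda>x. x $ l"]
    by (simp add: H_def[abs_def] g_def)
  have grad_div: "H i 1 $ 1 + H i 2 $ 2 + H i 3 $ 3 = 0" for i
  proof -
    have "dirderiv (axis i 1) (\<lambda>p. \<Sum>j\<in>UNIV. D j Z p \<bullet> axis j 1) p = 0"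
      by (simp add: sum_3 inner_axis divergence)
    then have "(\<Sum>j\<in>UNIV. H i j \<bullet> axis j 1) = 0"
      by (simp add: H_def dirderiv_sum dirderiv_inner_left differentiable_inner_right diff)
    then show ?thesis
      by (simp add: sum_3 inner_axis)
  qed
  have lap: "H 1 1 $ l + H 2 2 $ l + H 3 3 $ l = - ((\<mu> p)\<^sup>2 * Z p $ l)" for l
    using arg_cong[OF harmonic[of p, unfolded energy_eq], of "\<lambda>x. x $ l"]
    by (simp add: H_def sum_3)
  have curl_nth: "D 2 Z p $ 3 - D 3 Z p $ 2 = \<mu> p * Z p $ 1"
    "D 3 Z p $ 1 - D 1 Z p $ 3 = \<mu> p * Z p $ 2" "D 1 Z p $ 2 - D 2 Z p $ 1 = \<mu> p * Z p $ 3"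
    using curl_eq[of p] by (simp_all add: vec_eq_iff forall_3 curl_def vec_curl_components)
  have "g \<times> Z p = 0"
  proof -
    have "g $ 2 * Z p $ 3 - g $ 3 * Z p $ 2 = 0"
      using eq[of 2 3] eq[of 3 2] curl_nth(1) grad_div[of 1] lap[of 1]
      by (simp add: vec_curl_components sym power2_eq_square algebra_simps)
    moreover have "g $ 3 * Z p $ 1 - g $ 1 * Z p $ 3 = 0"
      using eq[of 3 1] eq[of 1 3] curl_nth(2) grad_div[of 2] lap[of 2]
      by (simp add: vec_curl_components sym power2_eq_square algebra_simps)
    moreover have "g $ 1 * Z p $ 2 - g $ 2 * Z p $ 1 = 0"
      using eq[of 1 2] eq[of 2 1] curl_nth(3) grad_div[of 3] lap[of 3]
      by (simp add: vec_curl_components sym power2_eq_square algebra_simps)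
    ultimately show ?thesis
      by (simp add: vec_eq_iff forall_3 cross_components)
  qed
  then have "g = (Z p \<bullet> g) *\<^sub>R Z p"
    by (rule parallel_of_cross_eq_0[OF unit])
  moreover have "Z p \<bullet> g = 0"
  proof -
    have "vec_curl (H 1) $ 1 + vec_curl (H 2) $ 2 + vec_curl (H 3) $ 3 = 0"
      by (simp add: vec_curl_components sym)
    moreover have "\<mu> p * (D 1 Z p $ 1 + D 2 Z p $ 2 + D 3 Z p $ 3) = 0"
      by (simp add: divergence)
    ultimately show ?thesis
      unfolding eq by (simp add: inner_vec_def sum_3 algebra_simps)
  qed
  ultimately have "g = 0"
    by (metis scale_zero_left)
  then have "D j \<mu> p = 0" for j
    by (simp add: g_def vec_eq_iff)
  then show ?thesis
    using dirderiv_expand[OF differentiable_\<mu>, of v p] by simp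
qed

text \<open>
  The constant value of \<open>\<mu>\<close>; it becomes the signed speed of the rotation.
\<close>

definition m :: real where "m = \<mu> 0"

lemma \<mu>_eq_m: "\<mu> p = m"
  unfolding m_def using constant_of_dirderiv_eq_0[OF differentiable_\<mu> \<mu>_derivative_zero] .

lemma energy_const: "(\<Sum>j\<in>UNIV. D j Z p \<bullet> D j Z p) = m\<^sup>2"
  using energy_eq \<mu>_eq_m by simp

lemma laplacian: "(\<Sum>j\<in>UNIV. D j (D j Z) p) = - m\<^sup>2 *\<^sub>R Z p"
  using harmonic energy_const by simp

lemma second_derivative_tangential: "dirderiv v (dirderiv w Z) p \<bullet> Z p = - (dirderiv v Z p \<bullet> dirderiv w Z p)"
proof -
  have "dirderiv v (\<lambda>p. dirderiv w Z p \<bullet> Z p) p = 0"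
    by (simp add: derivative_orthogonal)
  then show ?thesis
    by (simp add: dirderiv_inner diff inner_commute)
qed

text \<open>
  The Bochner identity: half the Laplacian of the constant \<open>|DZ|\<^sup>2\<close> is
  \<open>|D\<^sup>2Z|\<^sup>2 + \<langle>DZ, D (\<Delta> Z)\<rangle> = |D\<^sup>2Z|\<^sup>2 - m\<^sup>2 |DZ|\<^sup>2\<close>.
\<close>

lemma second_derivative_norm: "(\<Sum>i\<in>UNIV. \<Sum>j\<in>UNIV. D i (D j Z) p \<bullet> D i (D j Z) p) = m ^ 4"
proof -
  have d1: "(\<Sum>j\<in>UNIV. D i (D j Z) p \<bullet> D j Z p) = 0" for i p
  proof -
    have "D i (\<lambda>p. \<Sum>j\<in>UNIV. D j Z p \<bullet> D j Z p) p = 0"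
      by (simp add: energy_const)
    then have "2 * (\<Sum>j\<in>UNIV. D i (D j Z) p \<bullet> D j Z p) = 0"
      unfolding sum_distrib_left
      by (simp add: dirderiv_sum dirderiv_inner differentiable_inner diff inner_commute)
    then show ?thesis by simp
  qed
  have d2: "(\<Sum>j\<in>UNIV. D i (D i (D j Z)) p \<bullet> D j Z p + D i (D j Z) p \<bullet> D i (D j Z) p) = 0" for i
  proof -
    have "D i (\<lambda>p. \<Sum>j\<in>UNIV. D i (D j Z) p \<bullet> D j Z p) p = 0"
      by (simp add: d1)
    then show ?thesis
      by (simp add: dirderiv_sum dirderiv_inner differentiable_inner diff)
  qed
  have comm: "(\<Sum>i\<in>UNIV. D i (D i (D j Z)) p) = - m\<^sup>2 *\<^sub>R D j Z p" for j
  proof -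
    have eq: "D i (D j Z) = D j (D i Z)" for i
      using dirderiv_commute[OF smooth] by blast
    have "D i (D i (D j Z)) p = D j (D i (D i Z)) p" for i
      unfolding eq using dirderiv_commute[OF smooth_dirderiv[OF smooth]] by blast
    then have "(\<Sum>i\<in>UNIV. D i (D i (D j Z)) p) = D j (\<lambda>p. \<Sum>i\<in>UNIV. D i (D i Z) p) p"
      by (simp add: dirderiv_sum diff)
    also have "\<dots> = - m\<^sup>2 *\<^sub>R D j Z p"
      unfolding laplacian by (subst dirderiv_scaleR) (auto simp: diff)
    finally show ?thesis .
  qed
  have "(\<Sum>i\<in>UNIV. \<Sum>j\<in>UNIV. D i (D i (D j Z)) p \<bullet> D j Z p) = (\<Sum>j\<in>UNIV. (\<Sum>i\<in>UNIV. D i (D i (D j Z)) p) \<bullet> D j Z p)"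
    unfolding inner_sum_left by (rule sum.swap)
  also have "\<dots> = - m\<^sup>2 * (\<Sum>j\<in>UNIV. D j Z p \<bullet> D j Z p)"
    by (simp add: comm sum_distrib_left sum_negf)
  also have "\<dots> = - (m ^ 4)"
    by (simp add: energy_const)
  finally have "(\<Sum>i\<in>UNIV. \<Sum>j\<in>UNIV. D i (D i (D j Z)) p \<bullet> D j Z p) = - (m ^ 4)" .
  moreover have "(\<Sum>i\<in>UNIV. \<Sum>j\<in>UNIV. D i (D i (D j Z)) p \<bullet> D j Z p)
      + (\<Sum>i\<in>UNIV. \<Sum>j\<in>UNIV. D i (D j Z) p \<bullet> D i (D j Z) p) = 0"
    using d2 by (simp flip: sum.distrib)
  ultimately show ?thesis by simp
qed

lemma gram_sq: "(D i Z p \<bullet> D j Z p)\<^sup>2 = (D i Z p \<bullet> D i Z p) * (D j Z p \<bullet> D j Z p)"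
  using norm_cross_dot[of "D i Z p" "D j Z p"] columns_cross_eq_0[OF unit shape, where i = i and j = j]
  by (simp add: dot_square_norm power_mult_distrib)

text \<open>
  The sum over \<open>i\<close> and \<open>j\<close> of the squared lengths of the differences of the two sides is
  \<open>|D\<^sup>2Z|\<^sup>2\<close> minus the sum of the squares of the coefficients along \<open>Z\<close>. Since \<open>DZ\<close> has rank at most
  one, these squares add up to the square of \<open>|DZ|\<^sup>2\<close>, and the two terms cancel.
\<close>

lemma hessian: "D i (D j Z) p = - (D i Z p \<bullet> D j Z p) *\<^sub>R Z p"
proof -
  let ?E = "\<lambda>i j. D i (D j Z) p + (D i Z p \<bullet> D j Z p) *\<^sub>R Z p"
  have "?E i j \<bullet> ?E i j = D i (D j Z) p \<bullet> D i (D j Z) p - (D i Z p \<bullet> D i Z p) * (D j Z p \<bullet> D j Z p)" for i j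
    using second_derivative_tangential[of "axis i 1" "axis j 1" p]
    by (simp add: inner_add_left inner_add_right inner_unit inner_commute[of "Z p"] gram_sq[symmetric] power2_eq_square)
  then have "(\<Sum>i\<in>UNIV. \<Sum>j\<in>UNIV. ?E i j \<bullet> ?E i j) = m ^ 4 - (\<Sum>i\<in>UNIV. D i Z p \<bullet> D i Z p) * (\<Sum>j\<in>UNIV. D j Z p \<bullet> D j Z p)"
    by (simp add: sum_subtractf second_derivative_norm sum_product)
  also have "\<dots> = 0"
    by (simp add: energy_const power_numeral_reduce)
  finally have "?E i j \<bullet> ?E i j = 0"
    by (simp add: sum_nonneg_eq_0_iff sum_nonneg)
  then show ?thesis
    by (simp add: eq_neg_iff_add_eq_0)
qed

lemma gram_const: "D i Z p \<bullet> D j Z p = D i Z 0 \<bullet> D j Z 0"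
proof (rule constant_of_dirderiv_eq_0[where f = "\<lambda>p. D i Z p \<bullet> D j Z p"])
  fix p show "(\<lambda>p. D i Z p \<bullet> D j Z p) differentiable (at p)"
    by (intro differentiable_inner diff)
next
  fix v p
  have "D k (\<lambda>p. D i Z p \<bullet> D j Z p) p = 0" for k
    by (simp add: dirderiv_inner diff hessian derivative_orthogonal inner_commute[of "Z p"])
  then show "dirderiv v (\<lambda>p. D i Z p \<bullet> D j Z p) p = 0"
    using dirderiv_expand[OF differentiable_inner[OF diff(2)[of "axis i 1"] diff(2)[of "axis j 1"]], of v p] by simp
qed

text \<open>
  At the origin all partial derivatives are multiples of one unit vector \<open>w\<close>. The coefficients, divided
  by \<open>m\<close>, form \<open>u\<close>; since the Gram matrix is constant, the same \<open>u\<close> serves at every point.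
\<close>

lemma gram_rank_one:
  assumes "m \<noteq> 0"
  obtains u :: "real^3" where "norm u = 1" "\<And>i j p. D i Z p \<bullet> D j Z p = m\<^sup>2 * (u $ i * u $ j)"
proof -
  let ?c = "\<lambda>j. D j Z 0"
  have "\<exists>k. ?c k \<noteq> 0"
  proof (rule ccontr)
    assume "\<nexists>k. ?c k \<noteq> 0"
    then show False using energy_const[of 0] assms by simp
  qed
  then obtain k where k: "?c k \<noteq> 0" by blast
  define w where "w = (1 / norm (?c k)) *\<^sub>R ?c k"
  have w: "norm w = 1"
    using k by (simp add: w_def)
  have c: "?c i = (w \<bullet> ?c i) *\<^sub>R w" for i
  proof (rule parallel_of_cross_eq_0[OF w])
    show "?c i \<times> w = 0"
      using columns_cross_eq_0[OF unit shape, where i = i and j = k] by (simp add: w_def cross_mult_right)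
  qed
  define u :: "real^3" where "u = (\<chi> i. (w \<bullet> ?c i) / m)"
  have "w \<bullet> w = 1"
    using w by (simp add: dot_square_norm)
  then have cc: "?c i \<bullet> ?c j = m\<^sup>2 * (u $ i * u $ j)" for i j
    using arg_cong2[OF c[of i] c[of j], of inner] assms by (simp add: u_def power2_eq_square)
  have "(\<Sum>j\<in>UNIV. ?c j \<bullet> ?c j) = m\<^sup>2 * (u \<bullet> u)"
    unfolding cc inner_vec_def[of u u] inner_real_def sum_distrib_left ..
  then have "norm u = 1"
    using energy_const[of 0] assms by (simp add: norm_eq_1)
  then show ?thesis
    using that[of u] cc gram_const by metis
qed

text \<open>
  With \<open>W = D\<^sub>uZ\<close>, the equations \<open>D\<^sub>vZ = \<langle>v, u\<rangle> W\<close> and \<open>D\<^sub>vW = - m\<^sup>2 \<langle>v, u\<rangle> Z\<close> say that \<open>Z\<close> and \<open>W / m\<close>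
  rotate into each other with signed speed \<open>m\<close> along \<open>u\<close>.
\<close>

lemma parallel_or_rotation:
  "(\<forall>v p. dirderiv v Z p = 0) \<or>
   (\<exists>u v w \<alpha>. norm u = 1 \<and> norm v = 1 \<and> norm w = 1 \<and> u \<bullet> v = 0 \<and> u \<bullet> w = 0 \<and> v \<bullet> w = 0 \<and>
      \<alpha> \<noteq> 0 \<and> (\<forall>p. Z p = cos (\<alpha> * (p \<bullet> u)) *\<^sub>R v - sin (\<alpha> * (p \<bullet> u)) *\<^sub>R w))"
proof (cases "m = 0")
  case True
  have "D j Z p = 0" for j p
    using energy_const[of p] True by (simp add: sum_nonneg_eq_0_iff)
  then have "dirderiv v Z p = 0" for v p
    using dirderiv_expand[OF diff(1), of v p] by simp
  then show ?thesis
    by blast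
next
  case False
  obtain u :: "real^3" where u: "norm u = 1" "\<And>i j p. D i Z p \<bullet> D j Z p = m\<^sup>2 * (u $ i * u $ j)"
    using gram_rank_one[OF False] by blast
  have uu: "u \<bullet> u = 1"
    using u(1) by (simp add: dot_square_norm)
  have dd: "dirderiv v Z p \<bullet> dirderiv v' Z p = m\<^sup>2 * ((v \<bullet> u) * (v' \<bullet> u))" for v v' p
  proof -
    have "dirderiv v Z p \<bullet> dirderiv v' Z p = (\<Sum>j\<in>UNIV. \<Sum>i\<in>UNIV. v' $ j * (v $ i * (D i Z p \<bullet> D j Z p)))"
      unfolding dirderiv_expand[OF diff(1), of v] dirderiv_expand[OF diff(1), of v']
      by (simp add: inner_sum_left inner_sum_right sum_distrib_left)
    also have "\<dots> = m\<^sup>2 * ((v' \<bullet> u) * (v \<bullet> u))"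
      unfolding u(2) by (simp add: inner_vec_def sum_3 algebra_simps)
    finally show ?thesis
      by (simp add: mult.commute)
  qed
  define W where "W = dirderiv u Z"
  \<comment> \<open>By the Gram matrix, derivatives in directions orthogonal to \<open>u\<close> have length zero.\<close>
  have dZ: "dirderiv v Z p = (v \<bullet> u) *\<^sub>R W p" for v p
  proof -
    have lin: "linear (\<lambda>v. dirderiv v Z p)"
      by (rule linear_dirderiv[OF diff(1)])
    have "dirderiv (v - (v \<bullet> u) *\<^sub>R u) Z p = 0"
      using dd[of "v - (v \<bullet> u) *\<^sub>R u" p "v - (v \<bullet> u) *\<^sub>R u"] by (simp add: inner_diff_left uu)
    then show ?thesis
      by (simp add: W_def linear_diff[OF lin] linear_scale[OF lin])
  qed
  have WW: "W p \<bullet> W p = m\<^sup>2" for p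
    using dd[of u p u] by (simp add: W_def uu)
  have W_nz: "W p \<noteq> 0" for p
    using WW[of p] False by auto
  have Zu: "Z p \<bullet> u = 0" for p
    using dZ[of "Z p" p] geodesic[of p] W_nz[of p] by simp
  have uW: "W p \<bullet> u = 0" for p
  proof -
    have "dirderiv u (\<lambda>p. Z p \<bullet> u) p = 0"
      by (simp add: Zu)
    then show ?thesis
      by (simp add: dirderiv_inner_left diff W_def)
  qed
  have ZW: "Z p \<bullet> W p = 0" for p
    using derivative_orthogonal[of u p] by (simp add: W_def inner_commute)
  have W_eq: "W = (\<lambda>p. \<Sum>j\<in>UNIV. u $ j *\<^sub>R D j Z p)"
    unfolding W_def by (rule ext) (rule dirderiv_expand[OF diff(1)])
  have dW: "dirderiv v W p = - (m\<^sup>2 * (v \<bullet> u)) *\<^sub>R Z p" for v p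
  proof -
    have "D i W p = - (m\<^sup>2 * u $ i) *\<^sub>R Z p" for i
    proof -
      have "D i W p = (\<Sum>j\<in>UNIV. u $ j *\<^sub>R D i (D j Z) p)"
        unfolding W_eq
        by (subst dirderiv_sum) (auto simp: dirderiv_scaleR diff intro!: differentiable_scaleR)
      also have "\<dots> = - (m\<^sup>2 * u $ i * (u \<bullet> u)) *\<^sub>R Z p"
        unfolding hessian u(2) by (simp add: inner_vec_def sum_3 algebra_simps)
      finally show ?thesis
        by (simp add: uu)
    qed
    then have "dirderiv v W p = (\<Sum>i\<in>UNIV. v $ i *\<^sub>R - (m\<^sup>2 * u $ i) *\<^sub>R Z p)"
      using dirderiv_expand[of W p v] diff by (simp add: W_def)
    then show ?thesis
      by (simp add: inner_vec_def sum_3 algebra_simps)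
  qed
  have derZ: "(Z has_derivative (\<lambda>v. (v \<bullet> u) *\<^sub>R W p)) (at p)" for p
    using has_derivative_dirderiv[OF diff(1)] dZ by simp
  have derW: "(W has_derivative (\<lambda>v. - (m\<^sup>2 * (v \<bullet> u)) *\<^sub>R Z p)) (at p)" for p
    using has_derivative_dirderiv[of W p] diff(2) dW by (simp add: W_def)
  \<comment> \<open>Undoing the rotation of the frame formed by \<open>Z\<close> and \<open>W / m\<close> gives two constant fields.\<close>
  define G where "G p = cos (m * (p \<bullet> u)) *\<^sub>R Z p - (sin (m * (p \<bullet> u)) / m) *\<^sub>R W p" for p
  define H where "H p = sin (m * (p \<bullet> u)) *\<^sub>R Z p + (cos (m * (p \<bullet> u)) / m) *\<^sub>R W p" for p
  have "(G has_derivative (\<lambda>v. 0)) (at p)" for p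
    unfolding G_def using False
    by (auto intro!: derivative_eq_intros derZ derW simp: algebra_simps power2_eq_square)
  then have G: "G p = Z 0" for p
    using constant_of_derivative_eq_0[of G p 0] by (simp add: G_def)
  have "(H has_derivative (\<lambda>v. 0)) (at p)" for p
    unfolding H_def using False
    by (auto intro!: derivative_eq_intros derZ derW simp: algebra_simps power2_eq_square)
  then have H: "H p = (1 / m) *\<^sub>R W 0" for p
    using constant_of_derivative_eq_0[of H p 0] by (simp add: H_def)
  define w where "w = - (1 / m) *\<^sub>R W 0"
  have Z_eq: "Z p = cos (m * (p \<bullet> u)) *\<^sub>R Z 0 - sin (m * (p \<bullet> u)) *\<^sub>R w" for p
  proof -
    let ?c = "cos (m * (p \<bullet> u))" and ?s = "sin (m * (p \<bullet> u))"
    have "?c * ?c + ?s * ?s = 1"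
      using sin_cos_squared_add3 by simp
    then have "Z p = (?c * ?c + ?s * ?s) *\<^sub>R Z p"
      by (simp only: scaleR_one)
    also have "\<dots> = ?c *\<^sub>R G p + ?s *\<^sub>R H p"
      by (simp add: G_def H_def algebra_simps del: sin_cos_squared_add3)
    finally show ?thesis
      unfolding G H by (simp add: w_def)
  qed
  have norm_W: "norm (W 0) = \<bar>m\<bar>"
    by (simp add: norm_eq_sqrt_inner WW)
  have "norm w = 1" "u \<bullet> Z 0 = 0" "u \<bullet> w = 0" "Z 0 \<bullet> w = 0"
    using False Zu[of 0] uW[of 0] ZW[of 0] by (simp_all add: w_def norm_W inner_commute[of u])
  then show ?thesis
    using u(1) unit[of 0] False Z_eq by blast
qed

end

section \<open>Fields on the torus\<close>

lemma sum_Basis_axis: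
  fixes f :: "real^'n \<Rightarrow> 'b::comm_monoid_add"
  shows "(\<Sum>b\<in>Basis. f b) = (\<Sum>j\<in>UNIV. f (axis j 1))"
proof -
  have Basis: "(Basis :: (real^'n) set) = (\<lambda>j. axis j 1) ` UNIV"
    by (auto simp: Basis_vec_def)
  have inj: "inj (\<lambda>j. axis j 1 :: real^'n)"
    by (auto simp: inj_def axis_eq_axis)
  show ?thesis
    unfolding Basis sum.reindex[OF inj] o_def ..
qed

lemma lift_periodic:
  assumes "lattice L" "l \<in> L"
  shows "lift L \<zeta> (p + l) = lift L \<zeta> p"
proof -
  have "x - l \<in> L \<longleftrightarrow> x \<in> L" for x
  proof
    have "l - l - l \<in> L"
      using lattice_diff assms by blast
    moreover assume "x - l \<in> L"
    ultimately have "(x - l) - (l - l - l) \<in> L"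
      using lattice_diff assms(1) by blast
    then show "x \<in> L" by simp
  qed (use lattice_diff assms in blast)
  then have "torus_proj L (p + l) = torus_proj L p"
    by (auto simp: torus_proj_def lattice_rel_def diff_diff_eq[symmetric])
  then show ?thesis
    by (simp add: lift_def)
qed

lemma cov_deriv_eq_dirderiv: "cov_deriv X Z p = dirderiv (X p) Z p"
  by (simp add: cov_deriv_def dirderiv_def)

text \<open>
  The correction term of the second covariant derivative vanishes since the frame fields are constant.
\<close>

lemma rough_laplacian_eq:
  fixes Z :: "real^3 \<Rightarrow> real^3"
  assumes "smooth Z"
  shows "rough_laplacian Z p = - (\<Sum>j\<in>UNIV. D j (D j Z) p)"
proof -
  have "second_cov_deriv (\<lambda>_. b) (\<lambda>_. b) Z p = dirderiv b (dirderiv b Z) p" for b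
  proof -
    have "cov_deriv (\<lambda>_. b) Z = dirderiv b Z"
      by (rule ext) (rule cov_deriv_eq_dirderiv)
    then show ?thesis
      using linear_0[OF linear_dirderiv[OF smooth_differentiable[OF assms]]]
      by (simp add: second_cov_deriv_def cov_deriv_eq_dirderiv)
  qed
  then show ?thesis
    by (simp add: rough_laplacian_def sum_Basis_axis)
qed

theorem corollary2:
  fixes L :: "(real^3) set" and \<zeta> :: "(real^3) set \<Rightarrow> real^3"
  assumes "lattice L"
    and "harmonic_unit_vector_field L \<zeta>"
    and "totally_geodesic_integral_curves L \<zeta>"
  shows "parallel_field L \<zeta> \<or> rotation_along_parallel L \<zeta>"
proof -
  define Z where "Z = lift L \<zeta>"
  have Z: "smooth Z" and unit: "norm (Z p) = 1" for p
    using assms(2) torus_proj_in_flat_torus[of L p]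
    by (auto simp: harmonic_unit_vector_field_def unit_vector_field_def Z_def lift_def)
  have geodesic: "dirderiv (Z p) Z p = 0" for p
    using assms(3) by (simp add: totally_geodesic_integral_curves_def Z_def cov_deriv_eq_dirderiv)
  have "rough_laplacian Z p = cov_norm_sq Z p *\<^sub>R Z p" for p
    using assms(2) by (simp add: harmonic_unit_vector_field_def Z_def)
  then have harmonic_minus: "- (\<Sum>j\<in>UNIV. D j (D j Z) p) = (\<Sum>j\<in>UNIV. D j Z p \<bullet> D j Z p) *\<^sub>R Z p" for p
    unfolding rough_laplacian_eq[OF Z] cov_norm_sq_def cov_deriv_eq_dirderiv sum_Basis_axis
      dot_square_norm .
  have harmonic: "(\<Sum>j\<in>UNIV. D j (D j Z) p) = - (\<Sum>j\<in>UNIV. D j Z p \<bullet> D j Z p) *\<^sub>R Z p" for p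
    unfolding scaleR_minus_left harmonic_minus[symmetric] by simp
  have periodic: "Z (q + l) = Z q" if "l \<in> L" for q l
    unfolding Z_def using lift_periodic[OF assms(1) that] .
  interpret nilpotent_harmonic_field Z
    using Z unit geodesic harmonic
      geodesic_trace_minors2_eq_0[OF assms(1) periodic Z unit geodesic]
    by unfold_locales
  from parallel_or_rotation show ?thesis
  proof
    assume "\<forall>v p. dirderiv v Z p = 0"
    then show ?thesis
      by (simp add: parallel_field_def cov_deriv_eq_dirderiv Z_def)
  next
    assume "\<exists>u v w \<alpha>. norm u = 1 \<and> norm v = 1 \<and> norm w = 1 \<and> u \<bullet> v = 0 \<and> u \<bullet> w = 0 \<and> v \<bullet> w = 0 \<and>
      \<alpha> \<noteq> 0 \<and> (\<forall>p. Z p = cos (\<alpha> * (p \<bullet> u)) *\<^sub>R v - sin (\<alpha> * (p \<bullet> u)) *\<^sub>R w)"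
    then have "rotation_along_parallel L \<zeta>"
      unfolding rotation_along_parallel_def Z_def by - (rule exI[of _ "0::real^3"], simp only: diff_zero)
    then show ?thesis ..
  qed
qed

end
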